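(* Let $G_{1},G_{2},\ldots ,G_{n}$ be finite groups, let $\Gamma =G_{1}\ast G_{2}\ast \cdots \ast G_{n}$ be their free product and let $$s^{\prime }=\max_{1\le i\le n} d(G_{i}/G_{i}^{\prime }).$$ Then $$d\left( \widehat{\Gamma }\right) \geq n+s^{\prime }-1.$$
   Context: For a group $G$, $d(G)$ denotes the minimal number of generators of $G$, and $G'$ denotes the derived (commutator) subgroup of $G$. For a group $\Gamma$, $\widehat{\Gamma}$ denotes its profinite completion. For a profinite group $P$, $d(P)$ denotes the minimal number of topological generators of $P$, i.e. the smallest cardinality of a subset generating a dense subgroup of $P$.
   Formalization: The finite groups G_1,…,G_n are additionally assumed to be nontrivial, since the inequality fails otherwise (for n = 2 with both groups trivial, d = 0 < 1). *)

theory Defs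
  imports
    "HOL-Algebra.Product_Groups"
    "HOL-Algebra.Generated_Groups"
    "HOL-Analysis.Function_Topology"
    "HOL-Library.Extended_Nat"
begin

section \<open>Minimal numbers of generators\<close>

text \<open>
  All infinite cardinalities are identified with \<open>\<infinity>\<close>: the infimum runs over the finite
  generating sets, and it is \<open>\<infinity>\<close> if there are none.
\<close>

definition min_gens :: "('a, 'b) monoid_scheme \<Rightarrow> enat" where
  "min_gens G =
    (INF S \<in> {S. S \<subseteq> carrier G \<and> finite S \<and> generate G S = carrier G}. enat (card S))"

definition min_top_gens :: "('a, 'b) monoid_scheme \<Rightarrow> 'a topology \<Rightarrow> enat" where
  "min_top_gens P T =
    (INF S \<in> {S. S \<subseteq> carrier P \<and> finite S \<and> Abstract_Topology.closure_of T (generate P S) = carrier P}.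
      enat (card S))"

definition abelianization :: "('a, 'b) monoid_scheme \<Rightarrow> 'a set monoid" where
  "abelianization G = G Mod derived G (carrier G)"


section \<open>Free products\<close>

definition fp_words :: "'i set \<Rightarrow> ('i \<Rightarrow> ('a, 'b) monoid_scheme) \<Rightarrow> ('i \<times> 'a) list set" where
  "fp_words I G = lists (SIGMA i:I. carrier (G i))"

inductive fp_equiv :: "'i set \<Rightarrow> ('i \<Rightarrow> ('a, 'b) monoid_scheme) \<Rightarrow>
    ('i \<times> 'a) list \<Rightarrow> ('i \<times> 'a) list \<Rightarrow> bool"
  for I :: "'i set" and G :: "'i \<Rightarrow> ('a, 'b) monoid_scheme" where
  refl: "fp_equiv I G u u"
| sym: "fp_equiv I G u v \<Longrightarrow> fp_equiv I G v u"
| trans: "fp_equiv I G u v \<Longrightarrow> fp_equiv I G v w \<Longrightarrow> fp_equiv I G u w"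
| one: "i \<in> I \<Longrightarrow> fp_equiv I G (u @ [(i, \<one>\<^bsub>G i\<^esub>)] @ v) (u @ v)"
| mult: "i \<in> I \<Longrightarrow> x \<in> carrier (G i) \<Longrightarrow> y \<in> carrier (G i) \<Longrightarrow>
    fp_equiv I G (u @ [(i, x), (i, y)] @ v) (u @ [(i, x \<otimes>\<^bsub>G i\<^esub> y)] @ v)"

definition fp_rel :: "'i set \<Rightarrow> ('i \<Rightarrow> ('a, 'b) monoid_scheme) \<Rightarrow>
    (('i \<times> 'a) list \<times> ('i \<times> 'a) list) set" where
  "fp_rel I G = {(u, v). u \<in> fp_words I G \<and> v \<in> fp_words I G \<and> fp_equiv I G u v}"

definition free_product :: "'i set \<Rightarrow> ('i \<Rightarrow> ('a, 'b) monoid_scheme) \<Rightarrow>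
    ('i \<times> 'a) list set monoid" where
  "free_product I G =
    \<lparr>carrier = fp_words I G // fp_rel I G,
     monoid.mult = (\<lambda>A B. \<Union>u\<in>A. \<Union>v\<in>B. fp_rel I G `` {u @ v}),
     one = fp_rel I G `` {[]}\<rparr>"

definition fp_incl :: "'i set \<Rightarrow> ('i \<Rightarrow> ('a, 'b) monoid_scheme) \<Rightarrow> 'i \<Rightarrow> 'a \<Rightarrow>
    ('i \<times> 'a) list set" where
  "fp_incl I G i x = fp_rel I G `` {[(i, x)]}"

lemma equiv_fp_rel: "equiv (fp_words I G) (fp_rel I G)"
proof (rule equivI)
  show "fp_rel I G \<subseteq> fp_words I G \<times> fp_words I G" by (auto simp: fp_rel_def)
  show "refl_on (fp_words I G) (fp_rel I G)"
    by (rule refl_onI) (simp add: fp_rel_def fp_equiv.refl)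
  show "sym (fp_rel I G)"
    by (rule symI) (simp add: fp_rel_def fp_equiv.sym)
  show "trans (fp_rel I G)"
    by (rule transI) (use fp_equiv.trans in \<open>simp add: fp_rel_def, blast\<close>)
qed

lemma fp_equiv_append_left: "fp_equiv I G u v \<Longrightarrow> fp_equiv I G (w @ u) (w @ v)"
proof (induction rule: fp_equiv.induct)
  case refl
  show ?case by (rule fp_equiv.refl)
next
  case sym
  then show ?case by (blast intro: fp_equiv.sym)
next
  case trans
  then show ?case by (blast intro: fp_equiv.trans)
next
  case (one i u v)
  then show ?case using fp_equiv.one[of i I G "w @ u" v] by simp
next
  case (mult i x y u v)
  then show ?case using fp_equiv.mult[of i I x G y "w @ u" v] by simp
qed

lemma fp_equiv_append_right: "fp_equiv I G u v \<Longrightarrow> fp_equiv I G (u @ w) (v @ w)"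
proof (induction rule: fp_equiv.induct)
  case refl
  show ?case by (rule fp_equiv.refl)
next
  case sym
  then show ?case by (blast intro: fp_equiv.sym)
next
  case trans
  then show ?case by (blast intro: fp_equiv.trans)
next
  case (one i u v)
  then show ?case using fp_equiv.one[of i I G u "v @ w"] by simp
next
  case (mult i x y u v)
  then show ?case using fp_equiv.mult[of i I x G y u "v @ w"] by simp
qed

lemma fp_words_append: "u @ v \<in> fp_words I G \<longleftrightarrow> u \<in> fp_words I G \<and> v \<in> fp_words I G"
  by (simp add: fp_words_def)

lemma fp_rel_append:
  assumes "(u, u') \<in> fp_rel I G" "(v, v') \<in> fp_rel I G"
  shows "(u @ v, u' @ v') \<in> fp_rel I G"
proof -
  have "fp_equiv I G (u @ v) (u' @ v)"
    using assms(1) by (simp add: fp_rel_def fp_equiv_append_right)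
  moreover have "fp_equiv I G (u' @ v) (u' @ v')"
    using assms(2) by (simp add: fp_rel_def fp_equiv_append_left)
  ultimately have "fp_equiv I G (u @ v) (u' @ v')" by (rule fp_equiv.trans)
  then show ?thesis using assms by (simp add: fp_rel_def fp_words_append)
qed

lemma mult_free_product:
  assumes "u \<in> fp_words I G" "v \<in> fp_words I G"
  shows "fp_rel I G `` {u} \<otimes>\<^bsub>free_product I G\<^esub> fp_rel I G `` {v} = fp_rel I G `` {u @ v}"
proof -
  have "congruent2 (fp_rel I G) (fp_rel I G) (\<lambda>u v. fp_rel I G `` {u @ v})"
    by (rule congruent2I') (rule equiv_class_eq[OF equiv_fp_rel fp_rel_append])
  from UN_equiv_class2[OF equiv_fp_rel equiv_fp_rel this assms]
  show ?thesis by (simp add: free_product_def)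
qed

lemma carrier_free_product:
  "carrier (free_product I G) = (\<lambda>u. fp_rel I G `` {u}) ` fp_words I G"
  by (auto simp: free_product_def quotient_def)

lemma one_free_product: "\<one>\<^bsub>free_product I G\<^esub> = fp_rel I G `` {[]}"
  by (simp add: free_product_def)

lemma fp_left_inverse:
  assumes "\<And>i. i \<in> I \<Longrightarrow> group (G i)" "u \<in> fp_words I G"
  shows "\<exists>v \<in> fp_words I G. fp_equiv I G (v @ u) []"
  using assms(2)
proof (induction u)
  case Nil
  show ?case by (rule bexI[of _ "[]"]) (auto simp: fp_words_def intro: fp_equiv.refl)
next
  case (Cons p u)
  obtain i x where p: "p = (i, x)" by force
  from Cons.prems p have i: "i \<in> I" and x: "x \<in> carrier (G i)" and u: "u \<in> fp_words I G"
    by (auto simp: fp_words_def)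
  from Cons.IH[OF u] obtain v where v: "v \<in> fp_words I G" "fp_equiv I G (v @ u) []" by blast
  interpret Gi: group "G i" using assms(1) i .
  let ?w = "v @ [(i, inv\<^bsub>G i\<^esub> x)]"
  have "fp_equiv I G (v @ [(i, inv\<^bsub>G i\<^esub> x), (i, x)] @ u) (v @ [(i, \<one>\<^bsub>G i\<^esub>)] @ u)"
    using fp_equiv.mult[of i I "inv\<^bsub>G i\<^esub> x" G x v u] i x by simp
  moreover have "fp_equiv I G (v @ [(i, \<one>\<^bsub>G i\<^esub>)] @ u) (v @ u)"
    using i by (rule fp_equiv.one)
  ultimately have "fp_equiv I G (?w @ p # u) []"
    using v(2) p by (auto intro: fp_equiv.trans)
  moreover have "?w \<in> fp_words I G"
    using v(1) i x by (auto simp: fp_words_def)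
  ultimately show ?case by blast
qed

lemma group_free_product:
  assumes "\<And>i. i \<in> I \<Longrightarrow> group (G i)"
  shows "group (free_product I G)"
proof (rule groupI)
  have nil: "[] \<in> fp_words I G" by (simp add: fp_words_def)
  show "\<one>\<^bsub>free_product I G\<^esub> \<in> carrier (free_product I G)"
    using nil by (auto simp: one_free_product carrier_free_product)
  fix A assume "A \<in> carrier (free_product I G)"
  then obtain u where u: "u \<in> fp_words I G" "A = fp_rel I G `` {u}"
    by (auto simp: carrier_free_product)
  show "\<one>\<^bsub>free_product I G\<^esub> \<otimes>\<^bsub>free_product I G\<^esub> A = A"
    using u nil by (simp add: one_free_product mult_free_product)
  obtain v where v: "v \<in> fp_words I G" "fp_equiv I G (v @ u) []"
    using fp_left_inverse[of I G u] assms u(1) by blast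
  have "fp_rel I G `` {v @ u} = fp_rel I G `` {[]}"
    by (rule equiv_class_eq[OF equiv_fp_rel])
      (use u v nil in \<open>auto simp: fp_rel_def fp_words_append\<close>)
  then show "\<exists>B\<in>carrier (free_product I G). B \<otimes>\<^bsub>free_product I G\<^esub> A = \<one>\<^bsub>free_product I G\<^esub>"
    using u v by (auto simp: carrier_free_product one_free_product mult_free_product)
  fix B assume "B \<in> carrier (free_product I G)"
  then obtain v where v: "v \<in> fp_words I G" "B = fp_rel I G `` {v}"
    by (auto simp: carrier_free_product)
  show "A \<otimes>\<^bsub>free_product I G\<^esub> B \<in> carrier (free_product I G)"
    using u v by (simp add: mult_free_product) (simp add: carrier_free_product fp_words_append)
  fix C assume "C \<in> carrier (free_product I G)"
  then obtain w where w: "w \<in> fp_words I G" "C = fp_rel I G `` {w}"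
    by (auto simp: carrier_free_product)
  show "A \<otimes>\<^bsub>free_product I G\<^esub> B \<otimes>\<^bsub>free_product I G\<^esub> C =
      A \<otimes>\<^bsub>free_product I G\<^esub> (B \<otimes>\<^bsub>free_product I G\<^esub> C)"
    using u v w by (simp add: mult_free_product fp_words_append)
qed

lemma fp_incl_hom:
  assumes "i \<in> I" "group (G i)"
  shows "fp_incl I G i \<in> hom (G i) (free_product I G)"
proof (rule homI)
  interpret Gi: group "G i" by fact
  fix x assume x: "x \<in> carrier (G i)"
  then have wx: "[(i, x)] \<in> fp_words I G" using assms by (simp add: fp_words_def)
  then show "fp_incl I G i x \<in> carrier (free_product I G)"
    by (auto simp: fp_incl_def carrier_free_product)
  fix y assume y: "y \<in> carrier (G i)"
  then have wy: "[(i, y)] \<in> fp_words I G" using assms by (simp add: fp_words_def)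
  have "fp_equiv I G [(i, x), (i, y)] [(i, x \<otimes>\<^bsub>G i\<^esub> y)]"
    using fp_equiv.mult[of i I x G y "[]" "[]"] assms x y by simp
  then have "([(i, x), (i, y)], [(i, x \<otimes>\<^bsub>G i\<^esub> y)]) \<in> fp_rel I G"
    using assms x y by (auto simp: fp_rel_def fp_words_def)
  from equiv_class_eq[OF equiv_fp_rel this]
  show "fp_incl I G i (x \<otimes>\<^bsub>G i\<^esub> y) =
      fp_incl I G i x \<otimes>\<^bsub>free_product I G\<^esub> fp_incl I G i y"
    using wx wy by (simp add: fp_incl_def mult_free_product)
qed

lemma free_product_universal:
  assumes "group H" "\<And>i. i \<in> I \<Longrightarrow> group (G i)" "\<And>i. i \<in> I \<Longrightarrow> h i \<in> hom (G i) H"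
  shows "\<exists>f \<in> hom (free_product I G) H.
    \<forall>i\<in>I. \<forall>x\<in>carrier (G i). f (fp_incl I G i x) = h i x"
proof -
  interpret H: group H by fact
  define F where "F = (\<lambda>u. foldr (\<lambda>p r. h (fst p) (snd p) \<otimes>\<^bsub>H\<^esub> r) u \<one>\<^bsub>H\<^esub>)"
  have F_Nil [simp]: "F [] = \<one>\<^bsub>H\<^esub>"
    and F_Cons [simp]: "F (p # u) = h (fst p) (snd p) \<otimes>\<^bsub>H\<^esub> F u" for p u
    by (simp_all add: F_def)
  have hc: "h i x \<in> carrier H" if "i \<in> I" "x \<in> carrier (G i)" for i x
    using assms(3)[OF that(1)] that(2) by (auto simp: hom_def)
  have Fc: "F u \<in> carrier H" if "u \<in> fp_words I G" for u
    using that by (induction u) (auto simp: fp_words_def hc)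
  have Fapp: "F (u @ v) = F u \<otimes>\<^bsub>H\<^esub> F v" if "u \<in> fp_words I G" "v \<in> fp_words I G" for u v
    using that(1)
  proof (induction u)
    case Nil
    then show ?case using Fc[OF that(2)] by simp
  next
    case (Cons p u)
    then show ?case using Fc[OF that(2)] Fc[of u] by (auto simp: fp_words_def hc H.m_assoc)
  qed
  have wf: "(u \<in> fp_words I G \<longleftrightarrow> v \<in> fp_words I G) \<and> (u \<in> fp_words I G \<longrightarrow> F u = F v)"
    if "fp_equiv I G u v" for u v
    using that
  proof (induction rule: fp_equiv.induct)
    case (one i u v)
    interpret Gi: group "G i" using assms(2) one .
    interpret hi: group_hom "G i" H "h i"
      using assms(3)[OF one] by unfold_locales
    have "[(i, \<one>\<^bsub>G i\<^esub>)] \<in> fp_words I G" using one by (simp add: fp_words_def)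
    then show ?case
      by (auto simp: fp_words_append Fapp[OF _ iffD2[OF fp_words_append]] Fapp Fc
          simp del: append_Cons append_Nil)
  next
    case (mult i x y u v)
    interpret Gi: group "G i" using assms(2) mult(1) .
    interpret hi: group_hom "G i" H "h i"
      using assms(3)[OF mult(1)] by unfold_locales
    have w: "[(i, x), (i, y)] \<in> fp_words I G" "[(i, x \<otimes>\<^bsub>G i\<^esub> y)] \<in> fp_words I G"
      using mult by (simp_all add: fp_words_def)
    have "F [(i, x), (i, y)] = F [(i, x \<otimes>\<^bsub>G i\<^esub> y)]"
      using mult by simp
    then show ?case
      using w by (auto simp: fp_words_append Fapp simp del: append_Cons append_Nil F_Cons)
  qed auto
  define f where "f = (\<lambda>A. F (SOME u. u \<in> A))"
  have f: "f (fp_rel I G `` {u}) = F u" if "u \<in> fp_words I G" for u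
  proof -
    define v where "v = (SOME v. v \<in> fp_rel I G `` {u})"
    have "u \<in> fp_rel I G `` {u}" using that equiv_class_self[OF equiv_fp_rel] by blast
    then have "v \<in> fp_rel I G `` {u}" unfolding v_def by (rule someI)
    then have "fp_equiv I G u v" by (simp add: fp_rel_def)
    from wf[OF this] that have "F v = F u" by simp
    then show ?thesis by (simp only: f_def v_def)
  qed
  have "f \<in> hom (free_product I G) H"
    by (rule homI) (auto simp: carrier_free_product f Fc mult_free_product fp_words_append Fapp)
  moreover have "f (fp_incl I G i x) = h i x" if "i \<in> I" "x \<in> carrier (G i)" for i x
    using that f[of "[(i, x)]"] hc[OF that] by (simp add: fp_incl_def fp_words_def)
  ultimately show ?thesis by blast
qed


section \<open>Profinite completions\<close>

definition finite_index_normals :: "('a, 'b) monoid_scheme \<Rightarrow> 'a set set" where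
  "finite_index_normals G = {N. N \<lhd> G \<and> finite (carrier (G Mod N))}"

text \<open>
  The inverse limit of the finite quotients \<open>G Mod N\<close>. For \<open>M \<subseteq> N\<close>, the canonical map
  \<open>G Mod M \<rightarrow> G Mod N\<close> sends a coset \<open>X\<close> of \<open>M\<close> to the coset \<open>X <#>\<^bsub>G\<^esub> N\<close> of \<open>N\<close>.
\<close>

definition profinite_completion :: "('a, 'b) monoid_scheme \<Rightarrow> ('a set \<Rightarrow> 'a set) monoid" where
  "profinite_completion G =
    (product_group (finite_index_normals G) (\<lambda>N. G Mod N))
    \<lparr>carrier :=
      {x \<in> \<Pi>\<^sub>E N\<in>finite_index_normals G. carrier (G Mod N).
        \<forall>M\<in>finite_index_normals G. \<forall>N\<in>finite_index_normals G.
          M \<subseteq> N \<longrightarrow> x M <#>\<^bsub>G\<^esub> N = x N}\<rparr>"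

definition profinite_topology :: "('a, 'b) monoid_scheme \<Rightarrow> ('a set \<Rightarrow> 'a set) topology" where
  "profinite_topology G =
    subtopology
      (product_topology (\<lambda>N. discrete_topology (carrier (G Mod N))) (finite_index_normals G))
      (carrier (profinite_completion G))"

lemma topspace_profinite_topology [simp]:
  "topspace (profinite_topology G) = carrier (profinite_completion G)"
proof -
  have "carrier (profinite_completion G) \<subseteq>
      (\<Pi>\<^sub>E N\<in>finite_index_normals G. carrier (G Mod N))"
    unfolding profinite_completion_def by simp
  then show ?thesis
    unfolding profinite_topology_def by (simp add: Int_absorb1)
qed

context group
begin

lemma coset_project:
  assumes "M \<lhd> G" "N \<lhd> G" "M \<subseteq> N" "a \<in> carrier G"
  shows "(M #> a) <#> N = N #> a"
proof -
  interpret M: normal M G by fact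
  interpret N: normal N G by fact
  have "(M #> a) <#> N = M <#> (a <# N)"
    using assms M.subset N.subset
    by (simp add: r_coset_eq_set_mult l_coset_eq_set_mult set_mult_assoc)
  also have "\<dots> = M <#> (N #> a)"
    using N.coset_eq assms(4) by simp
  also have "\<dots> = (M <#> N) #> a"
    using assms(4) M.subset N.subset by (simp add: setmult_rcos_assoc)
  also have "M <#> N = N"
  proof
    show "M <#> N \<subseteq> N"
      using assms(3) N.m_closed by (auto simp: set_mult_def)
    show "N \<subseteq> M <#> N"
    proof
      fix x assume "x \<in> N"
      then have "x = \<one> \<otimes> x" using N.subset by auto
      then show "x \<in> M <#> N"
        using M.one_closed \<open>x \<in> N\<close> unfolding set_mult_def by blast
    qed
  qed
  finally show ?thesis .
qed

lemma project_mult: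
  assumes "M \<lhd> G" "N \<lhd> G" "M \<subseteq> N" "X \<in> carrier (G Mod M)" "Y \<in> carrier (G Mod M)"
  shows "(X <#> Y) <#> N = (X <#> N) <#> (Y <#> N)"
proof -
  obtain a b where ab: "a \<in> carrier G" "X = M #> a" "b \<in> carrier G" "Y = M #> b"
    using assms(4,5) unfolding carrier_FactGroup by blast
  have "X <#> Y = M #> (a \<otimes> b)"
    using ab normal.rcos_sum[OF assms(1)] by simp
  then have "(X <#> Y) <#> N = N #> (a \<otimes> b)"
    using ab coset_project[OF assms(1-3)] by simp
  also have "\<dots> = (N #> a) <#> (N #> b)"
    using ab normal.rcos_sum[OF assms(2)] by simp
  also have "\<dots> = (X <#> N) <#> (Y <#> N)"
    using ab coset_project[OF assms(1-3)] by simp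
  finally show ?thesis .
qed

lemma group_Mod_finite_index: "N \<in> finite_index_normals G \<Longrightarrow> group (G Mod N)"
  by (simp add: finite_index_normals_def normal.factorgroup_is_group)

lemma subgroup_profinite_completion:
  "subgroup (carrier (profinite_completion G))
    (product_group (finite_index_normals G) (\<lambda>N. G Mod N))"
    (is "subgroup ?P ?Q")
proof -
  have Q: "group ?Q" using group_Mod_finite_index by simp
  have normal: "N \<lhd> G" if "N \<in> finite_index_normals G" for N
    using that by (simp add: finite_index_normals_def)
  have one_proj: "M <#> N = N" if "M \<lhd> G" "N \<lhd> G" "M \<subseteq> N" for M N
    using coset_project[OF that one_closed] that
    by (simp add: normal_imp_subgroup subgroup.subset)
  show ?thesis
  proof (rule group.subgroupI[OF Q])
    show "?P \<subseteq> carrier ?Q" by (auto simp: profinite_completion_def)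
    have "\<one>\<^bsub>?Q\<^esub> \<in> ?P"
      using monoid.one_closed[OF group.is_monoid[OF Q]] one_proj normal
      by (auto simp: profinite_completion_def)
    then show "?P \<noteq> {}" by blast
  next
    fix x y assume x: "x \<in> ?P" and y: "y \<in> ?P"
    then have xQ: "x \<in> carrier ?Q" and yQ: "y \<in> carrier ?Q"
      by (auto simp: profinite_completion_def)
    have "(x \<otimes>\<^bsub>?Q\<^esub> y) \<in> carrier ?Q"
      using Q xQ yQ by (rule monoid.m_closed[OF group.is_monoid])
    moreover have "(x M <#> y M) <#> N = x N <#> y N"
      if "M \<in> finite_index_normals G" "N \<in> finite_index_normals G" "M \<subseteq> N" for M N
    proof -
      have "x M \<in> carrier (G Mod M)" "y M \<in> carrier (G Mod M)"
        using xQ yQ that(1) by auto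
      moreover have "x M <#> N = x N" "y M <#> N = y N"
        using x y that by (auto simp: profinite_completion_def)
      ultimately show ?thesis
        using project_mult[OF normal[OF that(1)] normal[OF that(2)] that(3)] by simp
    qed
    ultimately show "x \<otimes>\<^bsub>?Q\<^esub> y \<in> ?P"
      by (auto simp: profinite_completion_def)
  next
    fix x assume x: "x \<in> ?P"
    then have xQ: "x \<in> carrier ?Q" by (auto simp: profinite_completion_def)
    have "inv\<^bsub>?Q\<^esub> x \<in> carrier ?Q"
      using Q xQ by (rule group.inv_closed)
    moreover have "(inv\<^bsub>?Q\<^esub> x) M <#> N = (inv\<^bsub>?Q\<^esub> x) N"
      if MN: "M \<in> finite_index_normals G" "N \<in> finite_index_normals G" "M \<subseteq> N" for M N
    proof -
      have xM: "x M \<in> carrier (G Mod M)" using xQ MN(1) by auto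
      have xN: "x N \<in> carrier (G Mod N)" using xQ MN(2) by auto
      have "x M <#> N = x N" using x MN by (auto simp: profinite_completion_def)
      moreover obtain a where a: "a \<in> carrier G" "x M = M #> a"
        using xM by (auto simp: carrier_FactGroup)
      ultimately have "x N = N #> a"
        using coset_project[OF normal[OF MN(1)] normal[OF MN(2)] MN(3)] by simp
      then show ?thesis
        using xQ a MN coset_project[OF normal[OF MN(1)] normal[OF MN(2)] MN(3)] xM xN
        by (simp add: group_Mod_finite_index normal
            normal.inv_FactGroup normal.rcos_inv)
    qed
    ultimately show "inv\<^bsub>?Q\<^esub> x \<in> ?P"
      by (auto simp: profinite_completion_def)
  qed
qed

lemma group_profinite_completion: "group (profinite_completion G)"
proof -
  have "profinite_completion G =
    (product_group (finite_index_normals G) (\<lambda>N. G Mod N))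
      \<lparr>carrier := carrier (profinite_completion G)\<rparr>"
    by (simp add: profinite_completion_def)
  then show ?thesis
    using subgroup.subgroup_is_group[OF subgroup_profinite_completion]
      group_Mod_finite_index by simp
qed

lemma profinite_completion_map_hom:
  "(\<lambda>a. \<lambda>N\<in>finite_index_normals G. N #> a) \<in> hom G (profinite_completion G)"
proof (rule homI)
  fix a assume a: "a \<in> carrier G"
  show "(\<lambda>N\<in>finite_index_normals G. N #> a) \<in> carrier (profinite_completion G)"
    using a coset_project
    by (auto simp: profinite_completion_def carrier_FactGroup finite_index_normals_def)
  fix b assume b: "b \<in> carrier G"
  have "(N #> a) <#> (N #> b) = N #> (a \<otimes> b)" if "N \<in> finite_index_normals G" for N
    using that a b by (simp add: finite_index_normals_def normal.rcos_sum)
  then show "(\<lambda>N\<in>finite_index_normals G. N #> (a \<otimes> b)) =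
      (\<lambda>N\<in>finite_index_normals G. N #> a) \<otimes>\<^bsub>profinite_completion G\<^esub>
      (\<lambda>N\<in>finite_index_normals G. N #> b)"
    by (simp add: profinite_completion_def cong: restrict_cong)
qed

end

end

(*
  Choose i0 with d(G_i0/G_i0') = s' and a prime p such that G_i0/G_i0' has s' independent
  homomorphisms to Z/p. Let V be the tensor product, over the i different from i0, of the
  augmentation ideals of F_p[G_i]. Every such G_i acts on V and has at least |V| derivations into
  V; letting G_i0 act trivially, it has at least |V|^s' homomorphisms to V. By the universal
  property these combine to at least |V|^(n - 1 + s') homomorphisms from the free product to a
  finite group V x| Q, all with the same projection to Q. Such a homomorphism is determined
  by its values on lifts of d topological generators of the profinite completion, with |V|
  possible values at each of them. Hence n - 1 + s' <= d.
*)
theory Submission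
  imports Defs "HOL-Number_Theory.Cong" "HOL-Algebra.Multiplicative_Group"
    "HOL-Combinatorics.Permutations"
begin

section \<open>Topological generators of a profinite completion\<close>

text \<open>The profinite completion enters only through the fact that a dense subgroup maps onto
  every finite quotient; everything else is counting. The common projection to Q is what makes the
  count sharp: it leaves |V| values per generator instead of |V| |Q|. One module must have |V|
  derivations for every G_i with i different from i0. Let I_i be the augmentation ideal and W the
  tensor product of the other ideals. A coboundary of F_p[G_i] tensor W, with G_i acting on the left
  factor, takes values in I_i tensor W = V. The invariants have order |W|, so |W|^(|G_i| - 1) = |V|
  coboundaries remain, whether or not p divides |G_i|. A single prime has to serve all characters of
  G_i0. It exists because the number of generators of a finite abelian group is already attained
  modulo some prime. If s' = 0, then G_i0 contributes nothing and the exponent is n - 1. Finally |V|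
  > 1, needed to compare exponents, comes from the nontriviality of the groups G_i.\<close>

lemma (in group) profinite_eval_hom:
  assumes "N \<in> finite_index_normals G"
  shows "(\<lambda>x. x N) \<in> hom (profinite_completion G) (G Mod N)"
  using assms by (intro homI) (auto simp: profinite_completion_def)

text \<open>Prescribing the coordinate at \<open>N\<close> defines an open set, so a dense subgroup
  meets it and thus surjects onto \<open>G Mod N\<close>. Coset representatives of the coordinates
  of \<open>S\<close> at \<open>N\<close> then generate \<open>G\<close> up to
  \<open>N\<close>.\<close>

lemma (in group) topological_generators_lift:
  assumes N: "N \<in> finite_index_normals G"
    and S: "S \<subseteq> carrier (profinite_completion G)" "finite S"
    and dense: "Abstract_Topology.closure_of (profinite_topology G) (generate (profinite_completion G) S)
      = carrier (profinite_completion G)"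
  obtains S' where "S' \<subseteq> carrier G" "finite S'" "card S' \<le> card S"
    "\<And>y. y \<in> carrier G \<Longrightarrow> \<exists>t \<in> generate G S'. N #> t = N #> y"
proof -
  let ?P = "profinite_completion G"
  interpret N: normal N G using N by (simp add: finite_index_normals_def)
  interpret Q: group "G Mod N" by (rule N.factorgroup_is_group)
  interpret P: group ?P by (rule group_profinite_completion)
  interpret ev: group_hom ?P "G Mod N" "\<lambda>x. x N"
    by unfold_locales (rule profinite_eval_hom[OF N])
  interpret pr: group_hom G "G Mod N" "\<lambda>a. N #> a"
    by unfold_locales (rule N.r_coset_hom_Mod)
  have "\<exists>a. a \<in> carrier G \<and> x N = N #> a" if "x \<in> S" for x
    using ev.hom_closed[of x] that S(1) by (auto simp: carrier_FactGroup)
  then obtain r where r: "r x \<in> carrier G" "x N = N #> r x" if "x \<in> S" for x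
    by metis
  have rS: "r ` S \<subseteq> carrier G" using r by blast
  show thesis
  proof (rule that[of "r ` S"])
    show "r ` S \<subseteq> carrier G" by (rule rS)
    show "finite (r ` S)" "card (r ` S) \<le> card S" using S(2) by (auto intro: card_image_le)
    fix y assume y: "y \<in> carrier G"
    define \<eta> where "\<eta> = (\<lambda>N\<in>finite_index_normals G. N #> y)"
    have \<eta>: "\<eta> \<in> carrier ?P"
      using profinite_completion_map_hom y by (auto simp: hom_def \<eta>_def)
    \<comment> \<open>The points of the product that agree with \<eta>, the image of
      \<open>y\<close>, at the coordinate \<open>N\<close>.\<close>
    let ?W = "{x \<in> topspace (product_topology (\<lambda>N. discrete_topology (carrier (G Mod N)))
        (finite_index_normals G)). x N \<in> {N #> y}}"
    have "openin (product_topology (\<lambda>N. discrete_topology (carrier (G Mod N)))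
        (finite_index_normals G)) ?W"
      by (rule openin_continuous_map_preimage[OF continuous_map_product_projection[OF N]])
        (use y in \<open>auto simp: carrier_FactGroup\<close>)
    then have U: "openin (profinite_topology G) (?W \<inter> carrier ?P)"
      unfolding profinite_topology_def by (rule openin_subtopology_Int)
    have "\<eta> \<in> ?W \<inter> carrier ?P"
      using \<eta> N by (simp add: profinite_completion_def) (simp add: \<eta>_def)
    moreover have "\<eta> \<in> Abstract_Topology.closure_of (profinite_topology G) (generate ?P S)"
      using \<eta> dense by simp
    ultimately have "\<exists>z. z \<in> generate ?P S \<and> z \<in> ?W \<inter> carrier ?P"
      using iffD1[OF in_closure_of, THEN conjunct2, THEN spec, THEN mp, OF _ conjI[OF _ U]] by simp
    then obtain z where z: "z \<in> generate ?P S" "z N = N #> y" by blast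
    have "(\<lambda>x. x N) ` S = (\<lambda>a. N #> a) ` (r ` S)"
      using r(2) by (auto simp: image_image)
    then have "(\<lambda>x. x N) ` generate ?P S = (\<lambda>a. N #> a) ` generate G (r ` S)"
      using ev.generate_img[OF S(1)] pr.generate_img[OF rS] by simp
    then have "z N \<in> (\<lambda>a. N #> a) ` generate G (r ` S)" using z(1) by blast
    then obtain t where "t \<in> generate G (r ` S)" "z N = N #> t" by blast
    then show "\<exists>t \<in> generate G (r ` S). N #> t = N #> y" using z(2) by (intro bexI[of _ t]) simp
  qed
qed

text \<open>A homomorphism \<open>\<phi> k\<close> is determined by its values on at most
  \<open>card S\<close> elements, and each of these has at most \<open>c\<close> values. The gain
  lies in \<open>c\<close>, which may be much smaller than the order of \<open>H\<close>.\<close>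

lemma (in group) card_homs_le:
  assumes H: "group H" "finite (carrier H)"
    and K: "finite K" "\<And>k. k \<in> K \<Longrightarrow> \<phi> k \<in> hom G H"
    and separated: "\<And>k l. k \<in> K \<Longrightarrow> l \<in> K \<Longrightarrow> (\<And>x. x \<in> carrier G \<Longrightarrow> \<phi> k x = \<phi> l x) \<Longrightarrow> k = l"
    and bound: "\<And>x. x \<in> carrier G \<Longrightarrow> card ((\<lambda>k. \<phi> k x) ` K) \<le> c"
    and S: "S \<subseteq> carrier (profinite_completion G)" "finite S"
      "Abstract_Topology.closure_of (profinite_topology G) (generate (profinite_completion G) S)
        = carrier (profinite_completion G)"
  shows "card K \<le> c ^ card S"
proof (cases "K = {}")
  case False
  let ?Q = "product_group K (\<lambda>_. H)"
  define \<Phi> where "\<Phi> = (\<lambda>x. \<lambda>k\<in>K. \<phi> k x)"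
  interpret H: group H by (rule H)
  interpret Q: group ?Q using H by simp
  have \<phi>: "group_hom G H (\<phi> k)" if "k \<in> K" for k
    using K(2)[OF that] by unfold_locales
  interpret \<Phi>: group_hom G ?Q \<Phi>
  proof unfold_locales
    show "\<Phi> \<in> hom G ?Q"
      by (rule homI)
        (use K(2) in \<open>auto simp: \<Phi>_def hom_def Pi_iff cong: restrict_cong\<close>)
  qed
  \<comment> \<open>The common kernel of all \<open>\<phi> k\<close>. It has finite index because
    \<open>?Q\<close> is finite, and it lets one set of lifts serve every \<open>k\<close> at
    once.\<close>
  define N where "N = kernel G ?Q \<Phi>"
  have "finite (carrier ?Q)" using K(1) H(2) by (simp add: finite_PiE)
  moreover have "(\<lambda>X. the_elem (\<Phi> ` X)) ` carrier (G Mod N) \<subseteq> carrier ?Q"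
    unfolding N_def using \<Phi>.FactGroup_hom by (auto simp: hom_def)
  ultimately have "finite ((\<lambda>X. the_elem (\<Phi> ` X)) ` carrier (G Mod N))"
    by (rule finite_subset[rotated])
  then have "finite (carrier (G Mod N))"
    unfolding N_def by (rule finite_imageD[OF _ \<Phi>.FactGroup_inj_on])
  then have N: "N \<in> finite_index_normals G"
    using \<Phi>.normal_kernel by (simp add: finite_index_normals_def N_def)
  obtain S' where S': "S' \<subseteq> carrier G" "finite S'" "card S' \<le> card S"
    "\<And>y. y \<in> carrier G \<Longrightarrow> \<exists>t \<in> generate G S'. N #> t = N #> y"
    by (rule topological_generators_lift[OF N S]) blast
  have inj: "inj_on (\<lambda>k. \<lambda>x\<in>S'. \<phi> k x) K"
  proof (rule inj_onI, rule separated)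
    fix k l y assume k: "k \<in> K" and l: "l \<in> K" and y: "y \<in> carrier G"
      and eq: "(\<lambda>x\<in>S'. \<phi> k x) = (\<lambda>x\<in>S'. \<phi> l x)"
    interpret k: group_hom G H "\<phi> k" by (rule \<phi>[OF k])
    interpret l: group_hom G H "\<phi> l" by (rule \<phi>[OF l])
    have on_S': "\<phi> k x = \<phi> l x" if "x \<in> S'" for x
      using fun_cong[OF eq, of x] that by simp
    have gen: "\<phi> k t = \<phi> l t" if "t \<in> generate G S'" for t
      using that
    proof (induction rule: generate.induct)
      case (eng a b)
      then show ?case using generate_in_carrier[OF S'(1)] by simp
    qed (use S'(1) on_S' in auto)
    obtain t where t: "t \<in> generate G S'" "N #> t = N #> y" using S'(4)[OF y] by blast
    have tc: "t \<in> carrier G" using t(1) generate_in_carrier[OF S'(1)] by blast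
    have Nsub: "subgroup N G" using \<Phi>.subgroup_kernel N_def by simp
    have "t \<in> N #> y" using rcos_self[OF tc Nsub] t(2) by simp
    then obtain m where m: "m \<in> N" "t = m \<otimes> y" by (auto simp: r_coset_def)
    have "\<Phi> m = \<one>\<^bsub>?Q\<^esub>" "m \<in> carrier G" using m(1) by (auto simp: N_def kernel_def)
    then have "\<phi> k m = \<one>\<^bsub>H\<^esub>" "\<phi> l m = \<one>\<^bsub>H\<^esub>"
      using k l by (auto simp: \<Phi>_def dest: fun_cong[of _ _ k] fun_cong[of _ _ l])
    then show "\<phi> k y = \<phi> l y"
      using gen[OF t(1)] m(2) \<open>m \<in> carrier G\<close> y by simp
  qed
  have "card K \<le> card (PiE S' (\<lambda>x. (\<lambda>k. \<phi> k x) ` K))"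
    by (rule card_inj_on_le[OF inj]) (use K(1) S'(2) in \<open>auto intro!: finite_PiE\<close>)
  also have "\<dots> = (\<Prod>x\<in>S'. card ((\<lambda>k. \<phi> k x) ` K))"
    using S'(2) by (simp add: card_PiE)
  also have "\<dots> \<le> (\<Prod>x\<in>S'. c)"
    using bound S'(1) by (intro prod_mono) auto
  also have "\<dots> = c ^ card S'" by simp
  also have "\<dots> \<le> c ^ card S"
  \<comment> \<open>Lifts of distinct elements may coincide, so \<open>card S'\<close> can be
    smaller than \<open>card S\<close>; monotonicity in the exponent then needs
    \<open>1 \<le> c\<close>, which holds because \<open>K\<close> is nonempty.\<close>
  proof (rule power_increasing[OF S'(3)])
    have "0 < card ((\<lambda>k. \<phi> k \<one>) ` K)" using False K(1) by (simp add: card_gt_0_iff)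
    then show "1 \<le> c" using bound[OF one_closed] by linarith
  qed
  finally show ?thesis .
qed simp


section \<open>Generators of a finite abelian group modulo primes\<close>

text \<open>In additive notation this is kG. Adjoining it to a set of generators expresses
  generation of G/kG without passing to the quotient.\<close>

definition pow_image :: "('a, 'b) monoid_scheme \<Rightarrow> nat \<Rightarrow> 'a set" where
  "pow_image G k = (\<lambda>a. a [^]\<^bsub>G\<^esub> k) ` carrier G"

lemma (in group) mem_subgroup_of_coprime_pows:
  fixes m n :: nat
  assumes M: "subgroup M G" and b: "b \<in> carrier G"
    and "b [^] m \<in> M" "b [^] n \<in> M" "coprime m n"
  shows "b \<in> M"
proof -
  obtain u v :: int where uv: "u * int m + v * int n = 1"
    using bezout_int[of "int m" "int n"] assms(5) by auto
  have "b = b [^] (int m * u + int n * v)"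
    using uv b by (simp add: mult.commute)
  also have "\<dots> = (b [^] m) [^] u \<otimes> (b [^] n) [^] v"
    using b by (simp add: int_pow_mult int_pow_pow[symmetric] int_pow_int)
  also have "\<dots> \<in> M"
    using assms(3,4) M by (simp add: subgroup.m_closed subgroup_int_pow_closed)
  finally show ?thesis .
qed

lemma (in comm_group) finprod_mem_subgroup:
  assumes M: "subgroup M G" and "\<And>x. x \<in> A \<Longrightarrow> f x \<in> M"
  shows "finprod G f A \<in> M"
proof (cases "finite A")
  case True
  then show ?thesis using assms(2)
  proof induction
    case (insert x F)
    have f: "f y \<in> M" if "y \<in> insert x F" for y using insert.prems[OF that] .
    then have "f \<in> F \<rightarrow> carrier G" "f x \<in> carrier G" using subgroup.subset[OF M] by blast+
    with insert.hyps have "finprod G f (insert x F) = f x \<otimes> finprod G f F" by (rule finprod_insert)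
    then show ?case using insert.IH f subgroup.m_closed[OF M] by simp
  qed (simp add: subgroup.one_closed[OF M])
qed (simp add: finprod_infinite subgroup.one_closed[OF M])

text \<open>The quotient by \<open>M\<close> is cyclic of order \<open>p\<close>, generated by the
  class of \<open>b\<close>, and \<open>e\<close> is the exponent of \<open>b\<close>. It is well
  defined modulo \<open>p\<close>: if a power of \<open>b\<close> with exponent prime to
  \<open>p\<close> lay in \<open>M\<close>, then so would \<open>b\<close>, by Bezout.\<close>

lemma (in group) coordinate_mod_prime:
  fixes p :: nat
  assumes M: "M \<lhd> G" and p: "prime p"
    and b: "b \<in> carrier G" "b \<notin> M" "b [^] p \<in> M"
    and cover: "\<And>a. a \<in> carrier G \<Longrightarrow> \<exists>m\<in>M. \<exists>k::nat. a = m \<otimes> b [^] k"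
  obtains e :: "'a \<Rightarrow> nat" where
    "\<And>x y. x \<in> carrier G \<Longrightarrow> y \<in> carrier G \<Longrightarrow> [e (x \<otimes> y) = e x + e y] (mod p)"
    "\<And>m. m \<in> M \<Longrightarrow> e m = 0" "e b = 1"
proof -
  interpret M: normal M G by (rule M)
  have sub: "subgroup M G" by (rule M.subgroup_axioms)
  have unique_le: "[k = l] (mod p)"
    if "m \<in> M" "m' \<in> M" "m \<otimes> b [^] k = m' \<otimes> b [^] l" "k \<le> l" for m m' and k l :: nat
  proof (rule ccontr)
    assume "\<not> [k = l] (mod p)"
    then have "\<not> p dvd l - k" using that(4) by (metis cong_altdef_nat cong_sym)
    then have cop: "coprime (l - k) p" using p by (metis coprime_commute prime_imp_coprime)
    have "b [^] l = b [^] (l - k) \<otimes> b [^] k"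
      using b(1) that(4) by (simp add: nat_pow_mult)
    then have "m = m' \<otimes> b [^] (l - k)"
      using that b(1) M.subset by (simp add: m_assoc[symmetric] subset_iff)
    then have "b [^] (l - k) = inv m' \<otimes> m"
      using that b(1) M.subset by (simp add: m_assoc[symmetric] subset_iff)
    then have "b [^] (l - k) \<in> M" using that by simp
    then show False using mem_subgroup_of_coprime_pows[OF sub b(1) _ b(3) cop] b(2) by blast
  qed
  have unique: "[k = l] (mod p)"
    if "m \<in> M" "m' \<in> M" "m \<otimes> b [^] k = m' \<otimes> b [^] l" for m m' and k l :: nat
    using unique_le[OF that] unique_le[OF that(2,1) that(3)[symmetric]]
    by (meson cong_sym nat_le_linear)
  \<comment> \<open>Reducing the chosen exponent modulo \<open>p\<close> turns the congruences on
    \<open>M\<close> and at \<open>b\<close> into the equations \<open>e m = 0\<close> and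
    \<open>e b = 1\<close>.\<close>
  define e where "e = (\<lambda>a. (SOME k::nat. \<exists>m\<in>M. a = m \<otimes> b [^] k) mod p)"
  have e: "[e (m \<otimes> b [^] k) = k] (mod p)" if "m \<in> M" for m and k :: nat
  proof -
    let ?P = "\<lambda>l::nat. \<exists>m'\<in>M. m \<otimes> b [^] k = m' \<otimes> b [^] l"
    have "?P (SOME l. ?P l)" by (rule someI[of ?P k]) (use that in blast)
    then obtain m' where "m' \<in> M" "m \<otimes> b [^] k = m' \<otimes> b [^] (SOME l. ?P l)" by blast
    from unique[OF that this] show ?thesis by (simp add: e_def cong_def)
  qed
  have e_small: "e a < p" for a using prime_gt_0_nat[OF p] by (simp add: e_def)
  show thesis
  proof (rule that)
    fix x y assume xy: "x \<in> carrier G" "y \<in> carrier G"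
    obtain m k m' l where mk: "m \<in> M" "x = m \<otimes> b [^] (k::nat)" "m' \<in> M" "y = m' \<otimes> b [^] (l::nat)"
      using cover xy by metis
    \<comment> \<open>Normality of \<open>M\<close> moves \<open>m'\<close> past the power of
      \<open>b\<close>.\<close>
    have conj: "b [^] k \<otimes> m' \<otimes> inv (b [^] k) \<in> M"
      using M.inv_op_closed2 b(1) mk(3) by simp
    have "x \<otimes> y = (m \<otimes> (b [^] k \<otimes> m' \<otimes> inv (b [^] k))) \<otimes> b [^] (k + l)"
      using mk b(1) M.subset by (simp add: nat_pow_mult[symmetric] m_assoc subset_iff inv_solve_left)
    then have "[e (x \<otimes> y) = k + l] (mod p)" using e conj mk by simp
    moreover have "[e x + e y = k + l] (mod p)" using e mk by (simp add: cong_add)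
    ultimately show "[e (x \<otimes> y) = e x + e y] (mod p)" by (metis cong_sym cong_trans)
  next
    fix m assume m: "m \<in> M"
    show "e m = 0" using e[OF m, of 0] e_small[of m] m M.subset
      by (auto simp: cong_def)
  next
    show "e b = 1" using e[OF M.one_closed, of 1] e_small[of b] prime_gt_1_nat[OF p] b(1)
      by (auto simp: cong_def)
  qed
qed

text \<open>A dual system: \<open>S\<close> is independent modulo \<open>p\<close>-th powers and the
  \<open>e b\<close> are characters to Z/p dual to it. Residues are represented by naturals because
  they will serve as exponents of \<open>p\<close>-th roots of unity.\<close>

definition dual_coordinates ::
    "('a, 'b) monoid_scheme \<Rightarrow> nat \<Rightarrow> 'a set \<Rightarrow> ('a \<Rightarrow> 'a \<Rightarrow> nat) \<Rightarrow> bool" where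
  "dual_coordinates G p S e \<longleftrightarrow> S \<subseteq> carrier G \<and>
    (\<forall>b\<in>S. \<forall>x\<in>carrier G. \<forall>y\<in>carrier G. [e b (x \<otimes>\<^bsub>G\<^esub> y) = e b x + e b y] (mod p)) \<and>
    (\<forall>b\<in>S. \<forall>c\<in>S. e b c = (if b = c then 1 else 0))"

text \<open>Minimality replaces linear algebra over F_p. If \<open>S\<close> has least size among
  the sets generating modulo \<open>p\<close>-th powers, then \<open>b\<close> lies outside the
  subgroup generated by the other elements and the \<open>p\<close>-th powers, and the quotient by
  that subgroup is cyclic of order \<open>p\<close>.\<close>

lemma (in comm_group) dual_coordinates_mod_prime:
  fixes p :: nat
  assumes fin: "finite (carrier G)" and p: "prime p"
  obtains S e where "dual_coordinates G p S e" "generate G (S \<union> pow_image G p) = carrier G"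
proof -
  let ?P = "pow_image G p"
  have P: "?P \<subseteq> carrier G" by (auto simp: pow_image_def)
  let ?gen = "\<lambda>S. S \<subseteq> carrier G \<and> generate G (S \<union> ?P) = carrier G"
  have "?gen (carrier G)"
    using P generate_incl[of "carrier G \<union> ?P"] generate.incl[of _ "carrier G \<union> ?P" G] by auto
  then obtain S where S: "?gen S" and min: "\<And>S'. ?gen S' \<Longrightarrow> card S \<le> card S'"
    using ex_has_least_nat[of ?gen "carrier G" card] by blast
  have finS: "finite S" using S fin finite_subset by blast
  have "\<exists>e. (\<forall>x\<in>carrier G. \<forall>y\<in>carrier G. [e (x \<otimes> y) = e x + e y] (mod p)) \<and>
      (\<forall>c\<in>S. e c = (if b = c then 1 else 0::nat))" if b: "b \<in> S" for b
  proof -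
    define M where "M = generate G (S - {b} \<union> ?P)"
    have bc: "b \<in> carrier G" using b S by blast
    have sub: "subgroup M G"
      unfolding M_def by (rule generate_is_subgroup) (use S P in blast)
    have inM: "x \<in> M" if "x \<in> S - {b} \<union> ?P" for x
      using generate.incl[OF that] by (simp add: M_def)
    have "b \<notin> M"
    proof
      assume "b \<in> M"
      then have "S \<union> ?P \<subseteq> M" using inM by blast
      then have "carrier G \<subseteq> M" using generate_subgroup_incl[OF _ sub] S by metis
      then have "?gen (S - {b})" using S subgroup.subset[OF sub] M_def by blast
      then show False using min[of "S - {b}"] b finS card_Diff1_less[OF finS b] by simp
    qed
    moreover have "b [^] p \<in> M" using inM bc by (auto simp: pow_image_def)
    moreover have "\<exists>m\<in>M. \<exists>k::nat. a = m \<otimes> b [^] k" if "a \<in> carrier G" for a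
    proof -
      have "a \<in> generate G (S \<union> ?P)" using S that by simp
      then show ?thesis
      proof (induction rule: generate.induct)
        case one
        show ?case using subgroup.one_closed[OF sub] by (intro bexI[of _ \<one>] exI[of _ 0]) auto
      next
        case (incl h)
        show ?case
        proof (cases "h = b")
          case True
          then show ?thesis using bc subgroup.one_closed[OF sub]
            by (intro bexI[of _ \<one>] exI[of _ 1]) auto
        next
          case False
          then have "h \<in> M" using incl inM by blast
          then show ?thesis using subgroup.mem_carrier[OF sub]
            by (intro bexI[of _ h] exI[of _ 0]) auto
        qed
      next
        case (inv h)
        show ?case
        proof (cases "h = b")
          case True
          have "inv b [^] p \<in> M" using inM bc by (auto simp: pow_image_def)
          \<comment> \<open>The cover by natural powers must also reach the inverse of
            \<open>b\<close>: its \<open>p\<close>-th power lies in \<open>M\<close>, which leaves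
            the exponent \<open>p - 1\<close>.\<close>
          moreover have "inv b = inv b [^] p \<otimes> b [^] (p - 1)"
          proof -
            have "inv b [^] p = inv b \<otimes> inv (b [^] (p - 1))"
              using bc prime_gt_0_nat[OF p] by (metis Suc_diff_1 inv_closed nat_pow_Suc2 nat_pow_inv)
            then show ?thesis using bc by (simp add: m_assoc)
          qed
          ultimately show ?thesis using True by blast
        next
          case False
          then have "inv h \<in> M" using inv inM subgroup.m_inv_closed[OF sub] by blast
          then show ?thesis using subgroup.mem_carrier[OF sub]
            by (intro bexI[of _ "inv h"] exI[of _ 0]) auto
        qed
      next
        case (eng x y)
        then obtain m k m' l where *: "m \<in> M" "x = m \<otimes> b [^] (k::nat)" "m' \<in> M" "y = m' \<otimes> b [^] (l::nat)"
          by blast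
        then have "m \<in> carrier G" "m' \<in> carrier G" using subgroup.mem_carrier[OF sub] by auto
        then have "x \<otimes> y = (m \<otimes> m') \<otimes> b [^] (k + l)"
          using * bc by (simp add: nat_pow_mult[symmetric] m_ac)
        then show ?case using * subgroup.m_closed[OF sub] by blast
      qed
    qed
    ultimately obtain e :: "'a \<Rightarrow> nat" where "\<And>x y. x \<in> carrier G \<Longrightarrow> y \<in> carrier G \<Longrightarrow> [e (x \<otimes> y) = e x + e y] (mod p)"
      "\<And>m. m \<in> M \<Longrightarrow> e m = 0" "e b = 1"
      using coordinate_mod_prime[OF subgroup_imp_normal[OF sub] p bc] by blast
    then show ?thesis using inM by (intro exI[of _ e]) auto
  qed
  then obtain e where "\<And>b. b \<in> S \<Longrightarrow> (\<forall>x\<in>carrier G. \<forall>y\<in>carrier G. [e b (x \<otimes> y) = e b x + e b y] (mod p)) \<and>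
      (\<forall>c\<in>S. e b c = (if b = c then 1 else 0::nat))" by metis
  then show thesis using that[of S e] S unfolding dual_coordinates_def by blast
qed

text \<open>Additively, let H be the subgroup generated by \<open>S\<close>. From G = H + pG for
  each prime divisor p of the order, iteration along the prime factorization of |G| gives G = H +
  |G|G, and |G| annihilates G.\<close>

lemma (in comm_group) generate_eq_carrier_of_mod_primes:
  assumes fin: "finite (carrier G)" and S: "S \<subseteq> carrier G"
    and mod_p: "\<And>p. prime p \<Longrightarrow> p dvd order G \<Longrightarrow> generate G (S \<union> pow_image G p) = carrier G"
  shows "generate G S = carrier G"
proof -
  let ?H = "generate G S"
  have sub: "subgroup ?H G" by (rule generate_is_subgroup[OF S])
  have Hc: "h \<in> carrier G" if "h \<in> ?H" for h using subgroup.mem_carrier[OF sub that] .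
  have prime_case: "\<exists>h\<in>?H. \<exists>c\<in>carrier G. a = h \<otimes> c [^] p"
    if p: "prime p" "p dvd order G" and a: "a \<in> carrier G" for p a
  proof -
    have "a \<in> generate G (S \<union> pow_image G p)" using mod_p[OF p] a by simp
    then show ?thesis
    proof (induction rule: generate.induct)
      case one
      show ?case by (intro bexI[of _ \<one>]) (auto intro: generate.one)
    next
      case (incl x)
      then consider "x \<in> S" | c where "c \<in> carrier G" "x = c [^] p" by (auto simp: pow_image_def)
      then show ?case
      proof cases
        case 1
        then show ?thesis using S by (intro bexI[of _ x] bexI[of _ \<one>]) (auto intro: generate.incl)
      next
        case 2
        then show ?thesis by (intro bexI[of _ \<one>] bexI[of _ c]) (auto intro: generate.one)
      qed
    next
      case (inv x)
      then consider "x \<in> S" | c where "c \<in> carrier G" "x = c [^] p" by (auto simp: pow_image_def)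
      then show ?case
      proof cases
        case 1
        then show ?thesis using S by (intro bexI[of _ "inv x"] bexI[of _ \<one>]) (auto intro: generate.inv)
      next
        case 2
        then show ?thesis
          by (intro bexI[of _ \<one>] bexI[of _ "inv c"]) (auto intro: generate.one simp: nat_pow_inv)
      qed
    next
      case (eng x y)
      then obtain h c h' c' where *: "h \<in> ?H" "c \<in> carrier G" "x = h \<otimes> c [^] p"
        "h' \<in> ?H" "c' \<in> carrier G" "y = h' \<otimes> c' [^] p" by blast
      then have "x \<otimes> y = (h \<otimes> h') \<otimes> (c \<otimes> c') [^] p"
        using Hc by (simp add: nat_pow_distrib m_ac)
      with * show ?case
        by (intro bexI[of _ "h \<otimes> h'"] bexI[of _ "c \<otimes> c'"]) (simp_all add: generate.eng)
    qed
  qed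
  \<comment> \<open>Induction over the divisors of the order: split off a prime factor and apply
    \<open>prime_case\<close> to the element \<open>c\<close> obtained for the cofactor.\<close>
  have "\<exists>h\<in>?H. \<exists>c\<in>carrier G. a = h \<otimes> c [^] k"
    if "k dvd order G" "a \<in> carrier G" for k a
    using that
  proof (induction k arbitrary: a rule: less_induct)
    case (less k)
    have "0 < k" using less.prems(1) fin order_gt_0_iff_finite by (metis dvd_pos_nat)
    show ?case
    proof (cases "k = 1")
      case True
      then show ?thesis using less.prems generate.one by (intro bexI[of _ \<one>] bexI[of _ a]) auto
    next
      case False
      then obtain p where p: "prime p" "p dvd k" using prime_factor_nat by blast
      then obtain j where j: "k = p * j" by blast
      have "j < k" "j dvd order G" "p dvd order G"
        using j p \<open>0 < k\<close> less.prems(1) prime_gt_1_nat[OF p(1)] by (auto elim: dvd_mult_left dvd_mult_right)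
      then obtain h c where hc: "h \<in> ?H" "c \<in> carrier G" "a = h \<otimes> c [^] j"
        using less.IH less.prems(2) by blast
      obtain h' d where hd: "h' \<in> ?H" "d \<in> carrier G" "c = h' \<otimes> d [^] p"
        using prime_case[OF p(1) \<open>p dvd order G\<close> hc(2)] by blast
      have "a = (h \<otimes> h' [^] j) \<otimes> d [^] k"
        using hc hd Hc j by (simp add: nat_pow_distrib nat_pow_pow m_ac)
      moreover have "h \<otimes> h' [^] j \<in> ?H"
        using hc hd subgroup_int_pow_closed[OF sub, of h' "int j"]
        by (simp add: generate.eng int_pow_int)
      ultimately show ?thesis using hd by blast
    qed
  qed
  then have "carrier G \<subseteq> ?H"
    using pow_order_eq_1 Hc by (metis dvd_refl r_one subsetI)
  then show ?thesis using Hc by blast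
qed

text \<open>If \<open>s - 1\<close> elements sufficed modulo each prime divisor of the order, the
  Chinese remainder theorem would combine these families into \<open>s - 1\<close> elements that
  generate modulo every such prime, hence generate \<open>G\<close>.\<close>

lemma (in comm_group) dual_coordinates_of_min_gens:
  assumes fin: "finite (carrier G)" and s: "min_gens G = enat s"
  obtains p S e where "prime p" "dual_coordinates G p S e" "s \<le> card S"
proof (cases s)
  case 0
  \<comment> \<open>No coordinates are required here, and 2 is an arbitrary prime.\<close>
  then show thesis using that[of 2 "{}"] by (simp add: dual_coordinates_def)
next
  case (Suc r)
  have "\<exists>p S e. prime p \<and> dual_coordinates G p S e \<and> s \<le> card S"
  proof (rule ccontr)
    assume neg: "\<not> ?thesis"
    define P where "P = {p. prime p \<and> p dvd order G}"
    have finP: "finite P"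
      using fin order_gt_0_iff_finite by (auto simp: P_def intro: finite_subset[of _ "{..order G}"] dvd_imp_le)
    have "\<exists>b::nat \<Rightarrow> 'a. range b \<subseteq> carrier G \<and> generate G (b ` {..<r} \<union> pow_image G p) = carrier G"
      if "p \<in> P" for p
    proof -
      have p: "prime p" using that by (simp add: P_def)
      obtain S e where S: "dual_coordinates G p S e" "generate G (S \<union> pow_image G p) = carrier G"
        using dual_coordinates_mod_prime[OF fin p] by blast
      have "card S \<le> r" using neg p S(1) Suc by (meson not_less_eq_eq)
      have Sc: "S \<subseteq> carrier G" using S(1) by (simp add: dual_coordinates_def)
      obtain h where h: "bij_betw h {0..<card S} S"
        using ex_bij_betw_nat_finite finite_subset[OF Sc fin] by blast
      \<comment> \<open>Padding with \<one> gives the families for all primes the same index set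
        \<open>{..<r}\<close>, so that they can be combined index by index.\<close>
      define b where "b = (\<lambda>j. if j < card S then h j else \<one>)"
      have "range b \<subseteq> carrier G" using h Sc by (auto simp: b_def bij_betw_def)
      moreover have "S \<subseteq> b ` {..<r}" using h \<open>card S \<le> r\<close> by (force simp: b_def bij_betw_def)
      moreover have "pow_image G p \<subseteq> carrier G" by (auto simp: pow_image_def)
      ultimately have "generate G (b ` {..<r} \<union> pow_image G p) = carrier G"
        using S(2) mono_generate[of "S \<union> pow_image G p" "b ` {..<r} \<union> pow_image G p"]
          generate_incl[of "b ` {..<r} \<union> pow_image G p"] by blast
      then show ?thesis using \<open>range b \<subseteq> carrier G\<close> by blast
    qed
    then obtain b :: "nat \<Rightarrow> nat \<Rightarrow> 'a" where b: "\<And>p. p \<in> P \<Longrightarrow> range (b p) \<subseteq> carrier G"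
      "\<And>p. p \<in> P \<Longrightarrow> generate G (b p ` {..<r} \<union> pow_image G p) = carrier G"
      by metis
    have bc: "b p j \<in> carrier G" if "p \<in> P" for p j using b(1)[OF that] by blast
    \<comment> \<open>Chinese remainder weights: \<open>m p\<close> is prime to \<open>p\<close> and
      divisible by every other prime in \<open>P\<close>. Modulo \<open>p\<close>-th powers only the
      factor from \<open>p\<close> survives in \<open>a j\<close>.\<close>
    define m where "m = (\<lambda>p. \<Prod>(P - {p}))"
    define a where "a = (\<lambda>j. \<Otimes>p\<in>P. b p j [^] m p)"
    have ac: "a j \<in> carrier G" for j unfolding a_def by (rule finprod_closed) (auto intro: bc)
    have "generate G (a ` {..<r}) = carrier G"
    proof (rule generate_eq_carrier_of_mod_primes[OF fin])
      show "a ` {..<r} \<subseteq> carrier G" using ac by blast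
      fix p assume "prime p" "p dvd order G"
      then have p: "prime p" "p \<in> P" by (auto simp: P_def)
      define N where "N = generate G (a ` {..<r} \<union> pow_image G p)"
      have c: "a ` {..<r} \<union> pow_image G p \<subseteq> carrier G" using ac by (auto simp: pow_image_def)
      have sub: "subgroup N G" unfolding N_def by (rule generate_is_subgroup[OF c])
      have powN: "x [^] p \<in> N" if "x \<in> carrier G" for x
        using that unfolding N_def by (intro generate.incl) (auto simp: pow_image_def)
      have "b p j \<in> N" if "j < r" for j
      proof (rule mem_subgroup_of_coprime_pows[OF sub bc[OF p(2)] _ powN[OF bc[OF p(2)]]])
        let ?R = "\<Otimes>q\<in>P - {p}. b q j [^] m q"
        have R: "?R \<in> N"
        proof (rule finprod_mem_subgroup[OF sub])
          fix q assume q: "q \<in> P - {p}"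
          then have "p dvd m q" using p finP by (auto simp: m_def intro: dvd_prodI)
          then obtain k where "m q = k * p" by (metis dvd_div_mult_self)
          then have "b q j [^] m q = (b q j [^] k) [^] p" using bc q by (simp add: nat_pow_pow)
          then show "b q j [^] m q \<in> N" using powN bc q by simp
        qed
        have "a j = b p j [^] m p \<otimes> ?R"
        proof -
          have "(\<Otimes>q\<in>insert p (P - {p}). b q j [^] m q) = b p j [^] m p \<otimes> ?R"
            by (rule finprod_insert) (use finP bc p in auto)
          then show ?thesis using p by (simp add: a_def insert_absorb)
        qed
        moreover have "?R \<in> carrier G" using R subgroup.mem_carrier[OF sub] by blast
        ultimately have "b p j [^] m p = a j \<otimes> inv ?R"
          using bc p by (simp add: m_assoc)
        moreover have "a j \<in> N" unfolding N_def using that by (intro generate.incl) auto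
        ultimately show "b p j [^] m p \<in> N"
          using R sub by (simp add: subgroup.m_closed subgroup.m_inv_closed)
        show "coprime (m p) p"
          unfolding m_def by (rule prod_coprime_left) (use p in \<open>auto simp: P_def intro: primes_coprime\<close>)
      qed
      then have "b p ` {..<r} \<union> pow_image G p \<subseteq> N" using powN by (auto simp: pow_image_def)
      then have "carrier G \<subseteq> N" using generate_subgroup_incl[OF _ sub] b(2)[OF p(2)] by metis
      then show "generate G (a ` {..<r} \<union> pow_image G p) = carrier G"
        using subgroup.subset[OF sub] N_def by blast
    qed
    then have "min_gens G \<le> enat (card (a ` {..<r}))"
      unfolding min_gens_def using ac by (intro INF_lower) auto
    also have "\<dots> \<le> enat r" using card_image_le[of "{..<r}" a] by simp
    finally show False using s Suc by simp
  qed
  then show thesis using that by blast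
qed


section \<open>A monomial group\<close>

text \<open>\<open>I\<close> will consist of the indices other than i0. It may be empty: then
  \<open>D\<close> is a single point and \<open>V\<close> is a copy of the group of
  \<open>p\<close>-th roots of unity, the empty tensor product.\<close>

locale coordinate_functions =
  fixes I :: "'i set" and G :: "'i \<Rightarrow> ('a, 'b) monoid_scheme" and p :: nat
  assumes finite_I: "finite I"
    and group_G: "i \<in> I \<Longrightarrow> group (G i)"
    and finite_G: "i \<in> I \<Longrightarrow> finite (carrier (G i))"
    and p_gt_1: "1 < p"
begin

definition D :: "('i \<Rightarrow> 'a) set" where
  "D = PiE I (\<lambda>i. carrier (G i))"

text \<open>The action of G_i on its tensor factor, as left translation of the basis
  \<open>D\<close>. Being the identity off \<open>D\<close> makes it a permutation of the whole
  type, as \<open>permutes\<close> demands.\<close>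

definition shift :: "'i \<Rightarrow> 'a \<Rightarrow> ('i \<Rightarrow> 'a) \<Rightarrow> 'i \<Rightarrow> 'a" where
  "shift i g x = (if x \<in> D then x(i := g \<otimes>\<^bsub>G i\<^esub> x i) else x)"

text \<open>
  The \<open>p\<close>-th roots of unity serve as \<open>\<int>/p\<close>, written multiplicatively. Vanishing of the
  augmentation in the \<open>i\<close>-th tensor factor is triviality of all products along lines in
  direction \<open>i\<close>. The value 1 outside of \<open>D\<close> makes \<open>V\<close> finite.
\<close>

definition V :: "(('i \<Rightarrow> 'a) \<Rightarrow> complex) set" where
  "V = {v. (\<forall>x. x \<notin> D \<longrightarrow> v x = 1) \<and> (\<forall>x\<in>D. v x ^ p = 1) \<and>
    (\<forall>i\<in>I. \<forall>x\<in>D. (\<Prod>h\<in>carrier (G i). v (x(i := h))) = 1)}"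

text \<open>Everything that can act in the semidirect product, rather than the group generated by
  the shifts: closure under composition and inverses is then immediate, and finiteness follows from
  that of \<open>D\<close>.\<close>

definition T :: "(('i \<Rightarrow> 'a) \<Rightarrow> 'i \<Rightarrow> 'a) set" where
  "T = {q. q permutes D \<and> (\<forall>v. v \<circ> q \<in> V \<longleftrightarrow> v \<in> V)}"

text \<open>The pair \<open>(u, q)\<close> stands for the monomial transformation \<open>(x, c) \<mapsto> (q x, u x * c)\<close>.\<close>

definition monomial_group ::
    "((('i \<Rightarrow> 'a) \<Rightarrow> complex) \<times> (('i \<Rightarrow> 'a) \<Rightarrow> 'i \<Rightarrow> 'a)) monoid" where
  "monomial_group = \<lparr>carrier = V \<times> T,
    monoid.mult = (\<lambda>(u, q) (w, r). (\<lambda>x. u (r x) * w x, q \<circ> r)),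
    one = (\<lambda>_. 1, id)\<rparr>"

section \<open>Shifts and lines\<close>

lemma finite_D: "finite D"
  unfolding D_def using finite_I finite_G by (rule finite_PiE)

lemma D_mem: "x \<in> D \<Longrightarrow> i \<in> I \<Longrightarrow> x i \<in> carrier (G i)"
  by (auto simp: D_def)

lemma upd_D: "x \<in> D \<Longrightarrow> i \<in> I \<Longrightarrow> g \<in> carrier (G i) \<Longrightarrow> x(i := g) \<in> D"
  by (auto simp: D_def PiE_iff extensional_def)

lemma shift_not_D: "x \<notin> D \<Longrightarrow> shift i g x = x"
  by (simp add: shift_def)

lemma shift_D:
  assumes "i \<in> I" "g \<in> carrier (G i)"
  shows "shift i g x \<in> D \<longleftrightarrow> x \<in> D"
proof -
  interpret Gi: group "G i" using group_G assms(1) .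
  show ?thesis using assms upd_D D_mem by (auto simp: shift_def)
qed

lemma shift_shift:
  assumes "i \<in> I" "g \<in> carrier (G i)" "h \<in> carrier (G i)"
  shows "shift i g (shift i h x) = shift i (g \<otimes>\<^bsub>G i\<^esub> h) x"
proof -
  interpret Gi: group "G i" using group_G assms(1) .
  show ?thesis
    using assms shift_D[of i h x] D_mem[of x i] by (auto simp: shift_def Gi.m_assoc)
qed

lemma shift_one:
  assumes "i \<in> I"
  shows "shift i \<one>\<^bsub>G i\<^esub> x = x"
proof -
  interpret Gi: group "G i" using group_G assms(1) .
  show ?thesis using assms D_mem[of x i] by (auto simp: shift_def)
qed

lemma shift_upd_other:
  assumes "i \<noteq> j" "x \<in> D" "j \<in> I" "h \<in> carrier (G j)"
  shows "shift i g (x(j := h)) = (shift i g x)(j := h)"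
  using assms upd_D by (auto simp: shift_def fun_upd_twist)

lemma prod_line_shift:
  assumes "i \<in> I" "g \<in> carrier (G i)" "x \<in> D"
  shows "(\<Prod>h\<in>carrier (G i). f (shift i g (x(i := h)))) = (\<Prod>h\<in>carrier (G i). f (x(i := h)))"
proof -
  interpret Gi: group "G i" using group_G assms(1) .
  have "bij_betw (\<lambda>h. g \<otimes>\<^bsub>G i\<^esub> h) (carrier (G i)) (carrier (G i))"
    by (rule bij_betw_byWitness[where f' = "\<lambda>h. inv\<^bsub>G i\<^esub> g \<otimes>\<^bsub>G i\<^esub> h"])
      (use assms(2) in \<open>auto simp: Gi.m_assoc[symmetric]\<close>)
  from prod.reindex_bij_betw[OF this, of "\<lambda>h. f (x(i := h))"]
  show ?thesis using assms upd_D by (simp add: shift_def)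
qed

lemma prod_line_shift_other:
  assumes "i \<noteq> j" "x \<in> D" "j \<in> I"
  shows "(\<Prod>h\<in>carrier (G j). f (shift i g (x(j := h)))) =
    (\<Prod>h\<in>carrier (G j). f ((shift i g x)(j := h)))"
  using assms by (intro prod.cong) (simp_all add: shift_upd_other)

section \<open>The abelian group \<open>V\<close> and its invariance under shifts\<close>

lemma V_root: "v \<in> V \<Longrightarrow> v x ^ p = 1"
  by (cases "x \<in> D") (auto simp: V_def)

lemma V_nonzero: "v \<in> V \<Longrightarrow> v x \<noteq> 0"
  using V_root[of v x] p_gt_1 by (auto simp: power_0_left)

lemma V_one: "(\<lambda>_. 1) \<in> V"
  by (simp add: V_def)

lemma V_mult: "u \<in> V \<Longrightarrow> w \<in> V \<Longrightarrow> (\<lambda>x. u x * w x) \<in> V"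
  by (simp add: V_def power_mult_distrib prod.distrib)

lemma V_inverse: "u \<in> V \<Longrightarrow> (\<lambda>x. inverse (u x)) \<in> V"
  by (simp add: V_def power_inverse prod_inversef[unfolded comp_def])

lemma V_power: "u \<in> V \<Longrightarrow> (\<lambda>x. u x ^ k) \<in> V"
  by (induction k) (simp_all add: V_one V_mult)

lemma V_prod: "(\<And>b. b \<in> B \<Longrightarrow> u b \<in> V) \<Longrightarrow> (\<lambda>x. \<Prod>b\<in>B. u b x) \<in> V"
  by (induction B rule: infinite_finite_induct) (simp_all add: V_one V_mult)

lemma finite_V: "finite V"
proof -
  have "inj_on (\<lambda>v. restrict v D) V"
  proof (rule inj_onI, rule ext)
    fix v w x assume vw: "v \<in> V" "w \<in> V" and eq: "restrict v D = restrict w D"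
    have "x \<in> D \<Longrightarrow> v x = w x" using fun_cong[OF eq, of x] by simp
    then show "v x = w x" using vw by (cases "x \<in> D") (simp_all add: V_def)
  qed
  moreover have "finite {z::complex. z ^ p = 1}"
    using card_roots_unity_eq[of p] p_gt_1 by (intro card_ge_0_finite) simp
  then have "finite (PiE D (\<lambda>_. {z::complex. z ^ p = 1}))"
    using finite_D by (intro finite_PiE) auto
  moreover have "(\<lambda>v. restrict v D) ` V \<subseteq> PiE D (\<lambda>_. {z::complex. z ^ p = 1})"
    by (auto simp: V_root)
  ultimately show ?thesis by (metis finite_imageD finite_subset)
qed

text \<open>A shift in direction \<open>i\<close> permutes the points of each line in direction
  \<open>i\<close> and carries a line in any other direction to a parallel one.\<close>

lemma V_comp_shift:
  assumes i: "i \<in> I" and g: "g \<in> carrier (G i)" and v: "v \<in> V"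
  shows "v \<circ> shift i g \<in> V"
proof -
  have "(\<Prod>h\<in>carrier (G j). v (shift i g (x(j := h)))) = 1" if "j \<in> I" "x \<in> D" for j x
  proof (cases "i = j")
    case True
    then show ?thesis using that v i g by (simp add: prod_line_shift V_def)
  next
    case False
    have "shift i g x \<in> D" using shift_D i g that by simp
    then show ?thesis using False that v by (simp add: prod_line_shift_other V_def)
  qed
  then show ?thesis using v shift_D[OF i g] by (simp add: V_def shift_not_D)
qed

lemma shift_in_T:
  assumes i: "i \<in> I" and g: "g \<in> carrier (G i)"
  shows "shift i g \<in> T"
proof -
  interpret Gi: group "G i" using group_G i .
  have inv: "shift i (inv\<^bsub>G i\<^esub> g) (shift i g x) = x" "shift i g (shift i (inv\<^bsub>G i\<^esub> g) x) = x" for x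
    using i g by (simp_all add: shift_shift shift_one)
  have "bij (shift i g)"
    by (rule o_bij[of "shift i (inv\<^bsub>G i\<^esub> g)"]) (auto simp: inv)
  then have "shift i g permutes D"
    by (simp add: permutes_def bij_iff shift_not_D)
  moreover have "v \<in> V" if "v \<circ> shift i g \<in> V" for v
    using V_comp_shift[OF i Gi.inv_closed[OF g] that] by (simp add: comp_def inv)
  ultimately show ?thesis using V_comp_shift[OF i g] unfolding T_def by blast
qed

section \<open>The semidirect product\<close>

lemma finite_T: "finite T"
  using finite_permutations[OF finite_D] by (rule finite_subset[rotated]) (auto simp: T_def)

lemma id_in_T: "id \<in> T"
  by (simp add: T_def permutes_id)

lemma finite_monomial_group: "finite (carrier monomial_group)"
  by (simp add: monomial_group_def finite_V finite_T)

lemma group_monomial_group: "group monomial_group"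
proof (rule groupI)
  fix X Y assume "X \<in> carrier monomial_group" "Y \<in> carrier monomial_group"
  then obtain u q w r where XY: "X = (u, q)" "u \<in> V" "q \<in> T" "Y = (w, r)" "w \<in> V" "r \<in> T"
    by (auto simp: monomial_group_def)
  then have "(u \<circ> r) \<in> V" by (simp add: T_def)
  from V_mult[OF this XY(5)] have "(\<lambda>x. u (r x) * w x) \<in> V" by simp
  moreover have "q \<circ> r \<in> T"
    using XY by (auto simp: T_def permutes_compose comp_assoc[symmetric])
  ultimately show "X \<otimes>\<^bsub>monomial_group\<^esub> Y \<in> carrier monomial_group"
    using XY by (simp add: monomial_group_def)
next
  fix X assume "X \<in> carrier monomial_group"
  then obtain u q where X: "X = (u, q)" "u \<in> V" "q \<in> T" by (auto simp: monomial_group_def)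
  then have q: "q permutes D" by (simp add: T_def)
  have qinv: "v \<circ> Hilbert_Choice.inv q \<in> V \<longleftrightarrow> v \<in> V" for v
  proof -
    have "(v \<circ> Hilbert_Choice.inv q) \<circ> q = v" using permutes_inv_o(2)[OF q] by (simp add: comp_assoc)
    then show ?thesis using X(3) unfolding T_def by (metis (mono_tags, lifting) mem_Collect_eq)
  qed
  then have "Hilbert_Choice.inv q \<in> T" using permutes_inv[OF q] by (simp add: T_def)
  moreover have "(\<lambda>x. inverse (u (Hilbert_Choice.inv q x))) \<in> V"
    using V_inverse[OF iffD2[OF qinv X(2)]] by (simp add: comp_def)
  moreover have "(\<lambda>x. inverse (u (Hilbert_Choice.inv q (q x))) * u x) = (\<lambda>_. 1)"
    using V_nonzero[OF X(2)] permutes_inverses(2)[OF q] by auto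
  ultimately show "\<exists>Y\<in>carrier monomial_group. Y \<otimes>\<^bsub>monomial_group\<^esub> X = \<one>\<^bsub>monomial_group\<^esub>"
    using X permutes_inv_o(2)[OF q]
    by (intro bexI[of _ "(\<lambda>x. inverse (u (Hilbert_Choice.inv q x)), Hilbert_Choice.inv q)"])
      (simp_all add: monomial_group_def)
qed (auto simp: monomial_group_def V_one id_in_T mult.assoc)

text \<open>
  \<open>twist i v\<close> is \<open>shift i\<close> conjugated by \<open>erase i v\<close>, which need not lie in \<open>V\<close>: conjugation by
  elements of \<open>V\<close> itself gives fewer than \<open>card V\<close> homomorphisms if \<open>shift i\<close> has fixed points in
  \<open>V\<close>. Nothing is lost by erasing, since the products along lines determine the erased values.
\<close>

definition erase :: "'i \<Rightarrow> (('i \<Rightarrow> 'a) \<Rightarrow> complex) \<Rightarrow> ('i \<Rightarrow> 'a) \<Rightarrow> complex" where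
  "erase i v x = (if x i = \<one>\<^bsub>G i\<^esub> then 1 else v x)"

definition twist :: "'i \<Rightarrow> (('i \<Rightarrow> 'a) \<Rightarrow> complex) \<Rightarrow> 'a \<Rightarrow>
    (('i \<Rightarrow> 'a) \<Rightarrow> complex) \<times> (('i \<Rightarrow> 'a) \<Rightarrow> 'i \<Rightarrow> 'a)" where
  "twist i v g = (\<lambda>x. erase i v x / erase i v (shift i g x), shift i g)"

section \<open>Derivations into \<open>V\<close> as coboundaries\<close>

lemma erase_nonzero: "v \<in> V \<Longrightarrow> erase i v x \<noteq> 0"
  by (simp add: erase_def V_nonzero)

text \<open>Erasure depends on coordinate \<open>i\<close> alone, so a line in direction
  \<open>j\<close> is either erased entirely or left intact.\<close>

lemma prod_line_erase:
  assumes "v \<in> V" "i \<noteq> j" "j \<in> I" "x \<in> D"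
  shows "(\<Prod>h\<in>carrier (G j). erase i v (x(j := h))) = 1"
  using assms by (cases "x i = \<one>\<^bsub>G i\<^esub>") (simp_all add: erase_def V_def)

text \<open>The products of \<open>erase i v\<close> along lines in direction \<open>i\<close> need
  not be 1, but numerator and denominator have the same product there, since the shift permutes the
  line. In the other directions both products are 1.\<close>

lemma twist_in_V:
  assumes v: "v \<in> V" and i: "i \<in> I" and g: "g \<in> carrier (G i)"
  shows "(\<lambda>x. erase i v x / erase i v (shift i g x)) \<in> V"
proof -
  have "(\<Prod>h\<in>carrier (G j). erase i v (x(j := h)) / erase i v (shift i g (x(j := h)))) = 1"
    if j: "j \<in> I" and x: "x \<in> D" for j x
  proof (cases "i = j")
    case True
    have "(\<Prod>h\<in>carrier (G i). erase i v (x(i := h))) \<noteq> 0"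
      using erase_nonzero[OF v] finite_G[OF i] by simp
    then show ?thesis
      using prod_line_shift[OF i g x, of "erase i v"] True by (simp add: prod_dividef)
  next
    case False
    have "shift i g x \<in> D" using shift_D i g x by simp
    then show ?thesis
      using prod_line_shift_other[OF False x j, of "erase i v" g] prod_line_erase[OF v False j] x
      by (simp add: prod_dividef)
  qed
  moreover have "erase i v x ^ p = 1" for x using V_root[OF v] by (simp add: erase_def)
  ultimately show ?thesis
    using erase_nonzero[OF v] by (simp add: V_def shift_not_D power_divide)
qed

text \<open>The cocycle identity is a telescoping product: the factor
  \<open>erase i v (shift i h x)\<close> cancels.\<close>

lemma twist_hom:
  assumes v: "v \<in> V" and i: "i \<in> I"
  shows "twist i v \<in> hom (G i) monomial_group"
proof (rule homI)
  fix g assume g: "g \<in> carrier (G i)"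
  then show "twist i v g \<in> carrier monomial_group"
    using twist_in_V[OF v i] shift_in_T[OF i] by (simp add: twist_def monomial_group_def)
  fix h assume h: "h \<in> carrier (G i)"
  show "twist i v (g \<otimes>\<^bsub>G i\<^esub> h) = twist i v g \<otimes>\<^bsub>monomial_group\<^esub> twist i v h"
    using erase_nonzero[OF v]
    by (auto simp: twist_def monomial_group_def fun_eq_iff shift_shift[OF i g h])
qed

lemma twist_inj:
  assumes v: "v \<in> V" and w: "w \<in> V" and i: "i \<in> I"
    and eq: "\<And>g. g \<in> carrier (G i) \<Longrightarrow> twist i v g = twist i w g"
  shows "v = w"
proof -
  interpret Gi: group "G i" using group_G i .
  have off: "v x = w x" if x: "x \<in> D" "x i \<noteq> \<one>\<^bsub>G i\<^esub>" for x
  proof -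
    \<comment> \<open>At this point of the line the erased function is 1, so the twist by
      \<open>x i\<close> takes the value \<open>1 / v x\<close> there.\<close>
    let ?y = "x(i := \<one>\<^bsub>G i\<^esub>)"
    have xi: "x i \<in> carrier (G i)" using D_mem x i by simp
    have "shift i (x i) ?y = x" using x xi i upd_D by (simp add: shift_def)
    then have "1 / v x = 1 / w x"
      using eq[OF xi] x(2) by (auto simp: twist_def erase_def dest!: fun_cong[of _ _ ?y])
    then show ?thesis by simp
  qed
  show ?thesis
  proof (rule ext)
    fix x
    consider "x \<notin> D" | "x \<in> D" "x i \<noteq> \<one>\<^bsub>G i\<^esub>" | "x \<in> D" "x i = \<one>\<^bsub>G i\<^esub>" by blast
    then show "v x = w x"
    proof cases
      case 1
      then show ?thesis using v w by (simp add: V_def)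
    next
      case 2
      then show ?thesis by (rule off)
    next
      case 3
      let ?R = "\<lambda>u. \<Prod>h\<in>carrier (G i) - {\<one>\<^bsub>G i\<^esub>}. u (x(i := h)) :: complex"
      have "u x * ?R u = 1" if "u \<in> V" for u
      proof -
        have "(\<Prod>h\<in>carrier (G i). u (x(i := h))) = u (x(i := \<one>\<^bsub>G i\<^esub>)) * ?R u"
          by (rule prod.remove) (use finite_G i in auto)
        moreover have "x(i := \<one>\<^bsub>G i\<^esub>) = x" using 3 by auto
        ultimately show ?thesis using that i 3 by (simp add: V_def)
      qed
      moreover have "?R v = ?R w"
        by (rule prod.cong) (use 3 i upd_D off in auto)
      ultimately show ?thesis using v w by (metis mult_cancel_right mult_zero_right zero_neq_one)
    qed
  qed
qed

section \<open>Homomorphisms from an abelian group into \<open>V\<close>\<close>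

definition combination :: "'c set \<Rightarrow> ('c \<Rightarrow> 'c \<Rightarrow> nat) \<Rightarrow> ('c \<Rightarrow> ('i \<Rightarrow> 'a) \<Rightarrow> complex) \<Rightarrow> 'c \<Rightarrow>
    (('i \<Rightarrow> 'a) \<Rightarrow> complex) \<times> (('i \<Rightarrow> 'a) \<Rightarrow> 'i \<Rightarrow> 'a)" where
  "combination S e w a = (\<lambda>x. \<Prod>b\<in>S. w b x ^ e b a, id)"

lemma V_power_cong:
  assumes "v \<in> V" "[k = l] (mod p)"
  shows "v x ^ k = v x ^ l"
proof -
  have "v x ^ k = v x ^ (k mod p)" for k
  proof -
    have "v x ^ k = (v x ^ p) ^ (k div p) * v x ^ (k mod p)"
      by (simp flip: power_mult power_add)
    then show ?thesis using V_root[OF assms(1)] by simp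
  qed
  then show ?thesis using assms(2) unfolding cong_def by metis
qed

text \<open>The exponents \<open>e b\<close> are additive only modulo \<open>p\<close>, which
  suffices because all values of elements of \<open>V\<close> are \<open>p\<close>-th roots of
  unity. The permutation component is \<open>id\<close>, the trivial action intended for
  G_i0.\<close>

lemma combination_hom:
  assumes dual: "dual_coordinates A p S e" and w: "\<And>b. b \<in> S \<Longrightarrow> w b \<in> V"
  shows "combination S e w \<in> hom A monomial_group"
proof (rule homI)
  fix a
  show "combination S e w a \<in> carrier monomial_group"
    using V_prod[of S "\<lambda>b x. w b x ^ e b a"] V_power w id_in_T
    by (simp add: combination_def monomial_group_def)
  fix a' assume a: "a \<in> carrier A" "a' \<in> carrier A"
  have "w b x ^ e b (a \<otimes>\<^bsub>A\<^esub> a') = w b x ^ e b a * w b x ^ e b a'" if "b \<in> S" for b x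
    using V_power_cong[OF w[OF that]] dual a that by (simp add: dual_coordinates_def power_add[symmetric])
  then show "combination S e w (a \<otimes>\<^bsub>A\<^esub> a') =
      combination S e w a \<otimes>\<^bsub>monomial_group\<^esub> combination S e w a'"
    by (simp add: combination_def monomial_group_def prod.distrib[symmetric] cong: prod.cong)
qed

lemma combination_at_basis:
  assumes dual: "dual_coordinates A p S e" and "finite S" "b \<in> S"
  shows "fst (combination S e w b) = w b"
proof
  fix x
  have "(\<Prod>c\<in>S. w c x ^ e c b) = (\<Prod>c\<in>S. if c = b then w c x else 1)"
    using dual assms(3) by (intro prod.cong) (auto simp: dual_coordinates_def)
  also have "\<dots> = w b x" using assms(2,3) by simp
  finally show "fst (combination S e w b) x = w b x" by (simp add: combination_def)
qed

section \<open>Nontriviality of \<open>V\<close>\<close>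

lemma card_V_ge_2:
  assumes nontrivial: "\<And>i. i \<in> I \<Longrightarrow> \<not> trivial_group (G i)"
  shows "2 \<le> card V"
proof -
  obtain \<zeta> :: complex where \<zeta>: "\<zeta> ^ p = 1" "\<zeta> \<noteq> 1"
  proof -
    have "\<not> {z::complex. z ^ p = 1} \<subseteq> {1}"
      using card_roots_unity_eq[of p] p_gt_1 card_mono[of "{1::complex}" "{z. z ^ p = 1}"] by auto
    then show thesis using that by blast
  qed
  have \<zeta>0: "\<zeta> \<noteq> 0" using \<zeta>(1) p_gt_1 by (auto simp: power_0_left)
  have "\<exists>g\<in>carrier (G i). g \<noteq> \<one>\<^bsub>G i\<^esub>" if "i \<in> I" for i
  proof -
    interpret Gi: group "G i" using group_G that .
    show ?thesis using nontrivial[OF that] Gi.one_closed Gi.is_group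
      unfolding trivial_group_def by blast
  qed
  then obtain g where g: "\<And>i. i \<in> I \<Longrightarrow> g i \<in> carrier (G i)" "\<And>i. i \<in> I \<Longrightarrow> g i \<noteq> \<one>\<^bsub>G i\<^esub>"
    by metis
  \<comment> \<open>The coefficients of 1 - g_i in the integral group ring, an element of the
    augmentation ideal. Their elementary tensor, placed in the exponent of \<zeta>, is the
    nontrivial element \<open>v\<close>: its exponent at the identity point is 1.\<close>
  define c where "c = (\<lambda>i h. if h = \<one>\<^bsub>G i\<^esub> then 1 else if h = g i then -1 else 0 :: int)"
  have sum_c: "(\<Sum>h\<in>carrier (G i). c i h) = 0" if i: "i \<in> I" for i
  proof -
    interpret Gi: group "G i" using group_G i .
    have "(\<Sum>h\<in>carrier (G i). c i h) = (\<Sum>h\<in>{\<one>\<^bsub>G i\<^esub>, g i}. c i h)"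
      by (rule sum.mono_neutral_right) (use finite_G i g in \<open>auto simp: c_def\<close>)
    also have "\<dots> = 0" using g(2)[OF i] by (auto simp: c_def)
    finally show ?thesis .
  qed
  have prod_powi: "(\<Prod>h\<in>B. \<zeta> powi f h) = \<zeta> powi (\<Sum>h\<in>B. f h)" for B and f :: "'a \<Rightarrow> int"
    by (induction B rule: infinite_finite_induct) (simp_all add: \<zeta>0 power_int_add)
  define v where "v = (\<lambda>x. if x \<in> D then \<zeta> powi (\<Prod>i\<in>I. c i (x i)) else 1)"
  have "v \<in> V"
  proof -
    have "(\<Prod>h\<in>carrier (G i). v (x(i := h))) = 1" if i: "i \<in> I" and x: "x \<in> D" for i x
    proof -
      have "(\<Prod>j\<in>I. c j ((x(i := h)) j)) = c i h * (\<Prod>j\<in>I - {i}. c j (x j))" for h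
        using prod.remove[OF finite_I i, of "\<lambda>j. c j ((x(i := h)) j)"] by simp
      then have "(\<Prod>h\<in>carrier (G i). v (x(i := h))) =
          (\<Prod>h\<in>carrier (G i). \<zeta> powi (c i h * (\<Prod>j\<in>I - {i}. c j (x j))))"
        using upd_D[OF x i] by (intro prod.cong) (simp_all add: v_def)
      also have "\<dots> = \<zeta> powi ((\<Sum>h\<in>carrier (G i). c i h) * (\<Prod>j\<in>I - {i}. c j (x j)))"
        by (simp add: prod_powi sum_distrib_right)
      finally show ?thesis using sum_c[OF i] by simp
    qed
    moreover have "(\<zeta> powi k) ^ p = 1" for k
    proof -
      have "(\<zeta> powi k) ^ p = (\<zeta> powi int p) powi k"
        by (metis mult.commute power_int_mult power_int_of_nat)
      then show ?thesis using \<zeta>(1) by simp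
    qed
    ultimately show ?thesis by (simp add: V_def v_def)
  qed
  moreover have "v \<noteq> (\<lambda>_. 1)"
  proof
    let ?x = "\<lambda>i\<in>I. \<one>\<^bsub>G i\<^esub>"
    have "?x \<in> D" using group_G by (auto simp: D_def group.is_monoid)
    moreover have "(\<Prod>i\<in>I. c i (?x i)) = 1" by (rule prod.neutral) (simp add: c_def)
    ultimately have "v ?x = \<zeta>" by (simp add: v_def)
    moreover assume "v = (\<lambda>_. 1)"
    ultimately show False using \<zeta>(2) by simp
  qed
  ultimately have "card {v, \<lambda>_. 1} \<le> card V" using finite_V V_one by (intro card_mono) auto
  then show ?thesis using \<open>v \<noteq> (\<lambda>_. 1)\<close> by simp
qed

end


section \<open>The lower bound\<close>

lemma free_product_induct [consumes 1, case_names one incl_mult]: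
  assumes "x \<in> carrier (free_product I G)"
    and one: "P \<one>\<^bsub>free_product I G\<^esub>"
    and incl_mult: "\<And>i a x. i \<in> I \<Longrightarrow> a \<in> carrier (G i) \<Longrightarrow> fp_incl I G i a \<in> carrier (free_product I G) \<Longrightarrow>
      x \<in> carrier (free_product I G) \<Longrightarrow> P x \<Longrightarrow> P (fp_incl I G i a \<otimes>\<^bsub>free_product I G\<^esub> x)"
  shows "P x"
proof -
  obtain u where u: "u \<in> fp_words I G" "x = fp_rel I G `` {u}"
    using assms(1) by (auto simp: carrier_free_product)
  have "P (fp_rel I G `` {u})" using u(1)
  proof (induction u)
    case Nil
    then show ?case using one by (simp add: one_free_product)
  next
    case (Cons y u)
    obtain i a where y: "y = (i, a)" by force
    have ia: "i \<in> I" "a \<in> carrier (G i)" "[(i, a)] \<in> fp_words I G" "u \<in> fp_words I G"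
      using Cons.prems y by (auto simp: fp_words_def)
    have "P (fp_incl I G i a \<otimes>\<^bsub>free_product I G\<^esub> fp_rel I G `` {u})"
      by (rule incl_mult) (use ia Cons.IH in \<open>auto simp: carrier_free_product fp_incl_def\<close>)
    then show ?case using mult_free_product[OF ia(3,4)] y by (simp add: fp_incl_def)
  qed
  then show ?thesis using u(2) by simp
qed

lemma free_product_top_gens_bound:
  assumes J: "finite J" "i0 \<in> J"
    and group: "\<And>i. i \<in> J \<Longrightarrow> group (G i)"
    and finite: "\<And>i. i \<in> J \<Longrightarrow> finite (carrier (G i))"
    and nontrivial: "\<And>i. i \<in> J \<Longrightarrow> \<not> trivial_group (G i)"
    and s: "min_gens (abelianization (G i0)) = enat s"
    and gens: "S \<subseteq> carrier (profinite_completion (free_product J G))" "finite S"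
      "Abstract_Topology.closure_of (profinite_topology (free_product J G))
         (generate (profinite_completion (free_product J G)) S)
       = carrier (profinite_completion (free_product J G))"
  shows "card J - 1 + s \<le> card S"
proof -
  let ?\<Gamma> = "free_product J G" and ?A = "abelianization (G i0)"
  define I where "I = J - {i0}"
  interpret \<Gamma>: group ?\<Gamma> using group by (rule group_free_product)
  interpret G0: group "G i0" using group J(2) .
  interpret G0': normal "derived (G i0) (carrier (G i0))" "G i0" by (rule G0.derived_self_is_normal)
  let ?\<pi> = "\<lambda>a. derived (G i0) (carrier (G i0)) #>\<^bsub>G i0\<^esub> a"
  have \<pi>: "?\<pi> \<in> hom (G i0) ?A"
    unfolding abelianization_def by (rule G0'.r_coset_hom_Mod)
  have \<pi>_surj: "carrier ?A = ?\<pi> ` carrier (G i0)"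
    unfolding abelianization_def by (auto simp: carrier_FactGroup)
  interpret A: comm_group ?A
    unfolding abelianization_def by (rule G0.derived_quot_is_comm_group)
  have finA: "finite (carrier ?A)" using \<pi>_surj finite[OF J(2)] by simp
  obtain p B e where p: "prime p" and dual: "dual_coordinates ?A p B e" and B: "s \<le> card B"
    using A.dual_coordinates_of_min_gens[OF finA s] by blast
  have B_sub: "B \<subseteq> carrier ?A" using dual by (simp add: dual_coordinates_def)
  have finB: "finite B" using finite_subset[OF B_sub finA] .
  interpret CF: coordinate_functions I G p
    by (rule coordinate_functions.intro)
      (use J group finite prime_gt_1_nat[OF p] in \<open>auto simp: I_def\<close>)
  \<comment> \<open>One free parameter in \<open>V\<close> for each \<open>i \<in> I\<close> and one
    for each \<open>b \<in> B\<close>, so the order of \<open>K\<close> is a power of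
    \<open>card CF.V\<close> with exponent \<open>card I + card B\<close>.\<close>
  define K where "K = PiE I (\<lambda>_. CF.V) \<times> PiE B (\<lambda>_. CF.V)"
  define h where "h = (\<lambda>k i. if i = i0 then CF.combination B e (snd k) \<circ> ?\<pi> else CF.twist i (fst k i))"
  have h_hom: "h k i \<in> hom (G i) CF.monomial_group" if "k \<in> K" "i \<in> J" for k i
  proof (cases "i = i0")
    case True
    have "snd k b \<in> CF.V" if "b \<in> B" for b using that \<open>k \<in> K\<close> by (auto simp: K_def)
    then show ?thesis using True hom_compose[OF \<pi> CF.combination_hom[OF dual]] by (simp add: h_def)
  next
    case False
    then have "i \<in> I" "fst k i \<in> CF.V" using that by (auto simp: K_def I_def)
    then show ?thesis using False CF.twist_hom by (simp add: h_def)
  qed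
  have "\<forall>k\<in>K. \<exists>f. f \<in> hom ?\<Gamma> CF.monomial_group \<and>
      (\<forall>i\<in>J. \<forall>x\<in>carrier (G i). f (fp_incl J G i x) = h k i x)"
    using free_product_universal[where I = J and G = G, OF CF.group_monomial_group, unfolded Bex_def]
      group h_hom by simp
  from bchoice[OF this] obtain \<phi> where \<phi>: "\<And>k. k \<in> K \<Longrightarrow> \<phi> k \<in> hom ?\<Gamma> CF.monomial_group"
    and \<phi>_incl: "\<And>k i x. k \<in> K \<Longrightarrow> i \<in> J \<Longrightarrow> x \<in> carrier (G i) \<Longrightarrow> \<phi> k (fp_incl J G i x) = h k i x"
    by auto
  have incl: "fp_incl J G i x \<in> carrier ?\<Gamma>" if "i \<in> J" "x \<in> carrier (G i)" for i x
    using fp_incl_hom[where G = G, OF that(1) group[OF that(1)]] that(2) by (auto simp: hom_def)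
  have "card K \<le> card CF.V ^ card S"
  proof (rule \<Gamma>.card_homs_le[OF CF.group_monomial_group CF.finite_monomial_group _ \<phi> _ _ gens])
    show "finite K"
      unfolding K_def using CF.finite_I finB CF.finite_V by (intro finite_cartesian_product finite_PiE)
  next
    fix k l assume k: "k \<in> K" and l: "l \<in> K"
      and eq: "\<And>x. x \<in> carrier ?\<Gamma> \<Longrightarrow> \<phi> k x = \<phi> l x"
    have h_eq: "h k i x = h l i x" if "i \<in> J" "x \<in> carrier (G i)" for i x
      using eq[OF incl[OF that]] \<phi>_incl k l that by simp
    have "fst k = fst l"
    proof (rule PiE_ext)
      show "fst k \<in> PiE I (\<lambda>_. CF.V)" "fst l \<in> PiE I (\<lambda>_. CF.V)" using k l by (auto simp: K_def)
      fix i assume i: "i \<in> I"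
      show "fst k i = fst l i"
        by (rule CF.twist_inj[OF _ _ i])
          (use k l i h_eq[of i] in \<open>auto simp: K_def I_def h_def\<close>)
    qed
    moreover have "snd k = snd l"
    proof (rule PiE_ext)
      show "snd k \<in> PiE B (\<lambda>_. CF.V)" "snd l \<in> PiE B (\<lambda>_. CF.V)" using k l by (auto simp: K_def)
      fix b assume b: "b \<in> B"
      \<comment> \<open>The elements of \<open>B\<close> live in the abelianization, so the
        parameter at \<open>b\<close> is read off at a preimage of \<open>b\<close> in
        \<open>G i0\<close>.\<close>
      then obtain x where x: "x \<in> carrier (G i0)" "b = ?\<pi> x" using B_sub \<pi>_surj by blast
      then have "CF.combination B e (snd k) b = CF.combination B e (snd l) b"
        using h_eq[OF J(2) x(1)] by (simp add: h_def)
      then show "snd k b = snd l b" using CF.combination_at_basis[OF dual finB b] by metis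
    qed
    ultimately show "k = l" by (rule prod_eqI)
  next
    fix x assume x: "x \<in> carrier ?\<Gamma>"
    \<comment> \<open>On each factor the permutation component is a shift or the identity,
      independent of the parameters; by induction on words this persists on the free product. Hence
      only the component in \<open>V\<close> varies with \<open>k\<close>, and the bound
      \<open>c\<close> is \<open>card CF.V\<close>.\<close>
    have snd_eq: "snd (\<phi> k x) = snd (\<phi> l x)" if kl: "k \<in> K" "l \<in> K" for k l
    proof -
      interpret k: group_hom ?\<Gamma> CF.monomial_group "\<phi> k"
        using \<phi>[OF kl(1)] CF.group_monomial_group \<Gamma>.is_group
        by (simp add: group_hom_def group_hom_axioms_def)
      interpret l: group_hom ?\<Gamma> CF.monomial_group "\<phi> l"
        using \<phi>[OF kl(2)] CF.group_monomial_group \<Gamma>.is_group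
        by (simp add: group_hom_def group_hom_axioms_def)
      have snd_mult: "snd (X \<otimes>\<^bsub>CF.monomial_group\<^esub> Y) = snd X \<circ> snd Y" for X Y
        by (simp add: CF.monomial_group_def split_beta)
      from x show ?thesis
      proof (induction rule: free_product_induct)
        case one
        then show ?case by simp
      next
        case (incl_mult i a x)
        have "snd (h k i a) = snd (h l i a)"
          by (simp add: h_def CF.combination_def CF.twist_def)
        then show ?case using incl_mult kl by (simp add: snd_mult \<phi>_incl)
      qed
    qed
    have fst_V: "fst (\<phi> k x) \<in> CF.V" if "k \<in> K" for k
    proof -
      have "\<phi> k x \<in> carrier CF.monomial_group" using \<phi>[OF that] x by (auto simp: hom_def)
      then show ?thesis by (auto simp: CF.monomial_group_def)
    qed
    show "card ((\<lambda>k. \<phi> k x) ` K) \<le> card CF.V"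
    proof (rule card_inj_on_le[of fst])
      show "inj_on fst ((\<lambda>k. \<phi> k x) ` K)"
        by (rule inj_onI) (use snd_eq in \<open>blast intro: prod_eqI\<close>)
      show "fst ` (\<lambda>k. \<phi> k x) ` K \<subseteq> CF.V" using fst_V by blast
    qed (rule CF.finite_V)
  qed
  moreover have "card K = card CF.V ^ (card I + card B)"
    using CF.finite_I finB by (simp add: K_def card_cartesian_product card_PiE power_add)
  moreover have "2 \<le> card CF.V" by (rule CF.card_V_ge_2) (use nontrivial in \<open>simp add: I_def\<close>)
  \<comment> \<open>Two powers of \<open>card CF.V\<close> are compared; passing to the exponents
    requires a base greater than 1.\<close>
  ultimately have "card I + card B \<le> card S" by (simp add: power_increasing_iff)
  moreover have "card I = card J - 1" using J by (simp add: I_def)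
  ultimately show ?thesis using B by simp
qed

text \<open>Trivial factors have to be excluded: for \<open>n\<close> trivial groups the left side
  is 0 and the right side is \<open>n - 1\<close>.\<close>

theorem theorem3:
  fixes n :: nat and G :: "nat \<Rightarrow> ('a, 'b) monoid_scheme"
  assumes "n \<ge> 1"
    and "\<And>i. i \<in> {1..n} \<Longrightarrow> group (G i)"
    and "\<And>i. i \<in> {1..n} \<Longrightarrow> finite (carrier (G i))"
    and "\<And>i. i \<in> {1..n} \<Longrightarrow> \<not> trivial_group (G i)"
  shows "min_top_gens (profinite_completion (free_product {1..n} G))
           (profinite_topology (free_product {1..n} G))
         \<ge> enat n + Max ((\<lambda>i. min_gens (abelianization (G i))) ` {1..n}) - 1"
proof -
  let ?d = "\<lambda>i. min_gens (abelianization (G i))"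
  have "Max (?d ` {1..n}) \<in> ?d ` {1..n}" using assms(1) by (intro Max_in) auto
  then obtain i0 where i0: "i0 \<in> {1..n}" "Max (?d ` {1..n}) = ?d i0" by blast
  let ?A = "abelianization (G i0)"
  interpret G0: group "G i0" using assms(2) i0(1) .
  interpret A: comm_group ?A
    unfolding abelianization_def by (rule G0.derived_quot_is_comm_group)
  have "finite (carrier ?A)"
    using assms(3)[OF i0(1)] by (simp add: abelianization_def carrier_FactGroup)
  \<comment> \<open>The whole finite carrier generates, so the maximum is a finite number
    \<open>s\<close>.\<close>
  then have "?d i0 \<le> enat (card (carrier ?A))"
    unfolding min_gens_def
    using A.generate_incl[of "carrier ?A"] by (intro INF_lower) (auto intro: generate.incl)
  then obtain s where s: "?d i0 = enat s" by (metis enat_ile)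
  \<comment> \<open>Subtraction is truncated; \<open>1 \<le> n\<close> allows the 1 to be taken from
    \<open>n\<close>.\<close>
  have "enat n + enat s - 1 = enat (n - 1 + s)"
    using assms(1) by (simp add: one_enat_def)
  moreover have "enat (n - 1 + s) \<le> min_top_gens (profinite_completion (free_product {1..n} G))
           (profinite_topology (free_product {1..n} G))"
    unfolding min_top_gens_def
  proof (rule INF_greatest)
    fix S assume "S \<in> {S. S \<subseteq> carrier (profinite_completion (free_product {1..n} G)) \<and> finite S \<and>
      Abstract_Topology.closure_of (profinite_topology (free_product {1..n} G))
        (generate (profinite_completion (free_product {1..n} G)) S)
      = carrier (profinite_completion (free_product {1..n} G))}"
    then show "enat (n - 1 + s) \<le> enat (card S)"
      using free_product_top_gens_bound[of "{1..n}" i0 G s S] assms(2-4) i0(1) s by simp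
  qed
  ultimately show ?thesis using i0(2) s by simp
qed

end
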